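(* Let $\varepsilon\in(0,1]$, $\gamma\ge 1$, $\eta>0$, $\delta t>0$, and let $\mathcal T=(\mathcal M,\mathcal E)$ be a MAC grid of $\Omega$. Let $(\rho^n,\boldsymbol u^n)\in L_{\mathcal M}(\Omega)\times \boldsymbol H_{\mathcal E,0}(\Omega)$ be such that $\rho^n>0$ on $\Omega$. Then there exists a solution $(\rho^{n+1},\boldsymbol u^{n+1})\in L_{\mathcal M}(\Omega)\times\boldsymbol H_{\mathcal E,0}(\Omega)$ of the semi-implicit scheme $$\frac{1}{\delta t}(\rho_K^{n+1}-\rho_K^n)+\frac{1}{|K|}\sum_{\sigma\in\mathcal E(K)}F_{\sigma,K}(\rho^{n+1},\boldsymbol v^n)=0,\quad\forall K\in\mathcal M,$$ $$\frac{1}{\delta t}(\rho_{D_\sigma}^{n+1}u_\sigma^{n+1}-\rho_{D_\sigma}^nu_\sigma^n)+\frac{1}{|D_\sigma|}\sum_{\epsilon\in\tilde{\mathcal E}(D_\sigma)}F_{\epsilon,\sigma}(\rho^{n+1},\boldsymbol v^n)u^n_{\epsilon,\mathrm{up}}+\frac{1}{\varepsilon^2}(\partial^{(i)}_{\mathcal E}p^{n+1})_\sigma=0,\quad \forall\, 1\le i\le d,\ \forall\sigma\in\mathcal E^{(i)}_{\mathrm{int}},$$ satisfying $\rho^{n+1}>0$ on $\Omega$.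
   Context: Mesh. $\Omega\subset\mathbb R^d$ is open, bounded, connected, and its closure is a finite union of closed axis-parallel rectangles ($d=2$) or parallelepipeds ($d=3$). A MAC grid is a pair $\mathcal T=(\mathcal M,\mathcal E)$: $\mathcal M$ (primal mesh) is a structured, possibly non-uniform, partition of $\bar\Omega$ into closed axis-parallel rectangles/parallelepipeds $K$; $\mathcal E$ is the set of all ($(d-1)$-dimensional) edges of the cells; $\mathcal E(K)$ is the set of edges of $K$. $\mathcal E^{(i)}=\mathcal E^{(i)}_{\mathrm{int}}\cup\mathcal E^{(i)}_{\mathrm{ext}}$ are the (internal/external) edges orthogonal to the canonical basis vector $\boldsymbol e^{(i)}$; $\mathcal E_{\mathrm{int}}=\cup_i\mathcal E^{(i)}_{\mathrm{int}}$. $\sigma=K|L$ denotes the internal edge common to $K$ and $L$. $|\cdot|$ denotes Lebesgue measure of the appropriate dimension. $\boldsymbol\nu_{\sigma,K}$ is the unit normal to $\sigma$ outward to $K$. For $\sigma=K|L$, the dual cell is $D_\sigma=D_{\sigma,K}\cup D_{\sigma,L}$, where $D_{\sigma,K}$ is the half of $K$ adjacent to $\sigma$ ($|D_{\sigma,K}|=|K|/2$); for an external $\sigma\in\mathcal E(K)$, $D_\sigma=D_{\sigma,K}$. $\tilde{\mathcal E}(D_\sigma)$ is the set of edges of $D_\sigma$; for $\sigma,\sigma'\in\mathcal E^{(i)}$, $\epsilon=D_\sigma|D_{\sigma'}$ is the dual edge separating $D_\sigma$ and $D_{\sigma'}$. Spaces. $L_{\mathcal M}(\Omega)$: real functions constant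 on each $K\in\mathcal M$ (values $q_K$). $\boldsymbol H_{\mathcal E,0}(\Omega)=\prod_{i=1}^dH^{(i)}_{\mathcal E,0}(\Omega)$, where $H^{(i)}_{\mathcal E,0}(\Omega)$ is the set of functions constant on each $D_\sigma$, $\sigma\in\mathcal E^{(i)}$ (values $u_\sigma$), with $u_\sigma=0$ for external $\sigma$. For $q\in L_{\mathcal M}(\Omega)$ and $\sigma=K|L$: $|D_\sigma|q_{D_\sigma}=|D_{\sigma,K}|q_K+|D_{\sigma,L}|q_L$. Operators. $(\partial^{(i)}_{\mathcal E}q)_\sigma=\frac{|\sigma|}{|D_\sigma|}(q_L-q_K)\,\boldsymbol e^{(i)}\cdot\boldsymbol\nu_{\sigma,K}$ for $\sigma=K|L\in\mathcal E^{(i)}_{\mathrm{int}}$, and $0$ on external edges. For real $a$, $a^\pm=\frac12(a\pm|a|)$ (so $a^-\le0$). The pressure is $p(\rho)=\rho^\gamma$ and $p^{n+1}_K=p(\rho^{n+1}_K)$. Stabilised velocity. $v^n_\sigma=u^n_\sigma-\delta u_\sigma(\rho^{n+1})$ with $\delta u_\sigma(\rho^{n+1})=\frac{\eta\,\delta t}{\varepsilon^2}(\partial^{(i)}_{\mathcal E}p^{n+1})_\sigma$ for $\sigma\in\mathcal E^{(i)}_{\mathrm{int}}$, $v^n_\sigma=0$ for external $\sigma$. For $w=u^n,v^n,\delta u$: $w_{\sigma,K}=w_\sigma\,\boldsymbol e^{(i)}\cdot\boldsymbol\nu_{\sigma,K}$. By convention the split parts of $v^n_{\sigma,K}$ are $(v^n_{\sigma,K})^+:=(u^n_{\sigma,K})^+-(\delta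 u_{\sigma,K}(\rho^{n+1}))^-\ge0$ and $(v^n_{\sigma,K})^-:=(u^n_{\sigma,K})^--(\delta u_{\sigma,K}(\rho^{n+1}))^+\le0$. Fluxes. For $\sigma=K|L$: $F_{\sigma,K}(\rho^{n+1},\boldsymbol v^n)=|\sigma|\{\rho^{n+1}_K(v^n_{\sigma,K})^++\rho^{n+1}_L(v^n_{\sigma,K})^-\}$; $F_{\sigma,K}=0$ for external $\sigma$. Dual fluxes $F_{\epsilon,\sigma}$, $\sigma=K|L\in\mathcal E^{(i)}_{\mathrm{int}}$, $\epsilon\in\tilde{\mathcal E}(D_\sigma)$: $F_{\epsilon,\sigma}=0$ if $\epsilon\subset\partial\Omega$; if $\epsilon$ is orthogonal to $\boldsymbol e^{(i)}$ and lies inside a cell $K$ whose two edges in $\mathcal E^{(i)}$ are $\sigma,\sigma'$, then $F_{\epsilon,\sigma}=\frac12(F_{\sigma',K}-F_{\sigma,K})$; if $\epsilon$ is parallel to $\boldsymbol e^{(i)}$, so that it is the union of a half of $\tau\in\mathcal E(K)$ and a half of $\tau'\in\mathcal E(L)$, then $F_{\epsilon,\sigma}=\frac12(F_{\tau,K}+F_{\tau',L})$. Upwind value: for $\epsilon=D_\sigma|D_{\sigma'}$, $u^n_{\epsilon,\mathrm{up}}=u^n_\sigma$ if $F_{\epsilon,\sigma}(\rho^{n+1},\boldsymbol v^n)\ge0$ and $u^n_{\sigma'}$ otherwise. *)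

theory Defs
  imports "HOL-Analysis.Analysis"
begin

text \<open>Cells, dual cells and edges are sets of points; all of them are (possibly degenerate)
  closed boxes. Coordinate directions are the elements of the index type \<^typ>\<open>'d\<close>,
  and the canonical basis vector of direction \<open>i\<close> is \<open>axis i 1\<close>.\<close>

type_synonym 'd region = "(real^'d) set"


section \<open>Domain and MAC grid\<close>

definition mac_domain :: "'d::finite region \<Rightarrow> bool" where
  "mac_domain \<Omega> \<longleftrightarrow> open \<Omega> \<and> bounded \<Omega> \<and> connected \<Omega> \<and>
     (\<exists>B. finite B \<and> (\<forall>R\<in>B. \<exists>a b. (\<forall>i. a $ i < b $ i) \<and> R = cbox a b) \<and> closure \<Omega> = \<Union>B)"

text \<open>A partition into nondegenerate boxes. \emph{Structured} is read in its weakest form: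
  there are no hanging nodes, i.e. two cells meet in a common face (of any dimension, possibly
  empty). Grids made of cells of one global tensor product grid are a special case. The edge set
  is determined by the cells, so the grid is represented by its primal mesh \<open>M\<close>.\<close>

definition mac_grid :: "'d::finite region \<Rightarrow> 'd region set \<Rightarrow> bool" where
  "mac_grid \<Omega> M \<longleftrightarrow> M division_of (closure \<Omega>) \<and> (\<forall>K\<in>M. interior K \<noteq> {}) \<and>
     (\<forall>K\<in>M. \<forall>L\<in>M. (K \<inter> L) face_of K \<and> (K \<inter> L) face_of L)"

abbreviation lo :: "'d::finite region \<Rightarrow> 'd \<Rightarrow> real" where
  "lo K i \<equiv> interval_lowerbound K $ i"

abbreviation hi :: "'d::finite region \<Rightarrow> 'd \<Rightarrow> real" where
  "hi K i \<equiv> interval_upperbound K $ i"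

definition lower_edge :: "'d::finite \<Rightarrow> 'd region \<Rightarrow> 'd region" where
  "lower_edge i K = {x\<in>K. x $ i = lo K i}"

definition upper_edge :: "'d::finite \<Rightarrow> 'd region \<Rightarrow> 'd region" where
  "upper_edge i K = {x\<in>K. x $ i = hi K i}"

text \<open>The edges of a box orthogonal to direction \<open>i\<close>. The set of all edges of the box is the
  disjoint union of these sets over \<open>i\<close>; this is used for primal and for dual cells.\<close>

definition edges :: "'d::finite \<Rightarrow> 'd region \<Rightarrow> 'd region set" where
  "edges i K = {lower_edge i K, upper_edge i K}"

definition mesh_edges :: "'d::finite region set \<Rightarrow> 'd \<Rightarrow> 'd region set" where
  "mesh_edges M i = (\<Union>K\<in>M. edges i K)"

definition ext_edges :: "'d::finite region \<Rightarrow> 'd region set \<Rightarrow> 'd \<Rightarrow> 'd region set" where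
  "ext_edges \<Omega> M i = {\<sigma> \<in> mesh_edges M i. \<sigma> \<subseteq> frontier \<Omega>}"

definition int_edges :: "'d::finite region \<Rightarrow> 'd region set \<Rightarrow> 'd \<Rightarrow> 'd region set" where
  "int_edges \<Omega> M i = mesh_edges M i - ext_edges \<Omega> M i"

text \<open>For an internal edge \<open>\<sigma> = K|L\<close> orthogonal to direction \<open>i\<close>: the cell \<open>L\<close> on the other
  side of \<open>\<sigma>\<close>, seen from \<open>K\<close>.\<close>

definition neighbour :: "'d::finite region set \<Rightarrow> 'd \<Rightarrow> 'd region \<Rightarrow> 'd region \<Rightarrow> 'd region" where
  "neighbour M i \<sigma> K = (THE L. L \<in> M \<and> L \<noteq> K \<and> \<sigma> \<in> edges i L)"

text \<open>For an internal edge: the adjacent cell whose outward normal at \<open>\<sigma>\<close> is \<open>+axis i 1\<close>. It serves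
  as the \<open>K\<close> in \<open>\<sigma> = K|L\<close> in the formulas that are symmetric in \<open>K\<close> and \<open>L\<close>.\<close>

definition lower_cell :: "'d::finite region set \<Rightarrow> 'd \<Rightarrow> 'd region \<Rightarrow> 'd region" where
  "lower_cell M i \<sigma> = (THE K. K \<in> M \<and> \<sigma> = upper_edge i K)"

text \<open>The edge of \<open>K\<close> opposite to \<open>\<sigma>\<close>.\<close>

definition opposite_edge :: "'d::finite \<Rightarrow> 'd region \<Rightarrow> 'd region \<Rightarrow> 'd region" where
  "opposite_edge i K \<sigma> = (THE \<sigma>'. \<sigma>' \<in> edges i K \<and> \<sigma>' \<noteq> \<sigma>)"

definition outward_normal :: "'d::finite \<Rightarrow> 'd region \<Rightarrow> 'd region \<Rightarrow> real^'d" where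
  "outward_normal i \<sigma> K = (if \<sigma> = upper_edge i K then axis i 1 else - axis i 1)"

text \<open>The \<open>(d-1)\<close>-dimensional measure of an edge orthogonal to direction \<open>i\<close>, which is a box of
  side length zero in direction \<open>i\<close>.\<close>

definition edge_measure :: "'d::finite \<Rightarrow> 'd region \<Rightarrow> real" where
  "edge_measure i \<sigma> = (\<Prod>j\<in>UNIV - {i}. hi \<sigma> j - lo \<sigma> j)"

definition half_cell :: "'d::finite \<Rightarrow> 'd region \<Rightarrow> 'd region \<Rightarrow> 'd region" where
  "half_cell i \<sigma> K =
     (if \<sigma> = upper_edge i K then {x\<in>K. (lo K i + hi K i) / 2 \<le> x $ i}
      else {x\<in>K. x $ i \<le> (lo K i + hi K i) / 2})"

definition adjacent_cells :: "'d::finite region set \<Rightarrow> 'd \<Rightarrow> 'd region \<Rightarrow> 'd region set" where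
  "adjacent_cells M i \<sigma> = {K\<in>M. \<sigma> \<in> edges i K}"

definition dual_cell :: "'d::finite region set \<Rightarrow> 'd \<Rightarrow> 'd region \<Rightarrow> 'd region" where
  "dual_cell M i \<sigma> = (\<Union>K\<in>adjacent_cells M i \<sigma>. half_cell i \<sigma> K)"


section \<open>Discrete function spaces\<close>

text \<open>The closed cells overlap on their boundaries, so a piecewise constant function is required
  to be constant on the interior of each cell only; as usual, its values on the (null) skeleton
  are irrelevant.\<close>

definition const_on :: "'d::finite region \<Rightarrow> (real^'d \<Rightarrow> real) \<Rightarrow> bool" where
  "const_on A f \<longleftrightarrow> (\<exists>c. \<forall>x\<in>interior A. f x = c)"

definition val :: "(real^'d::finite \<Rightarrow> real) \<Rightarrow> 'd region \<Rightarrow> real" where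
  "val f A = (THE c. \<forall>x\<in>interior A. f x = c)"

definition L_space :: "'d::finite region set \<Rightarrow> (real^'d \<Rightarrow> real) set" where
  "L_space M = {q. \<forall>K\<in>M. const_on K q}"

definition H_space_comp ::
    "'d::finite region \<Rightarrow> 'd region set \<Rightarrow> 'd \<Rightarrow> (real^'d \<Rightarrow> real) set" where
  "H_space_comp \<Omega> M i = {w. (\<forall>\<sigma>\<in>mesh_edges M i. const_on (dual_cell M i \<sigma>) w) \<and>
     (\<forall>\<sigma>\<in>ext_edges \<Omega> M i. val w (dual_cell M i \<sigma>) = 0)}"

definition H_space ::
    "'d::finite region \<Rightarrow> 'd region set \<Rightarrow> ('d \<Rightarrow> real^'d \<Rightarrow> real) set" where
  "H_space \<Omega> M = {u. \<forall>i. u i \<in> H_space_comp \<Omega> M i}"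

definition positive_on_cells :: "'d::finite region set \<Rightarrow> (real^'d \<Rightarrow> real) \<Rightarrow> bool" where
  "positive_on_cells M q \<longleftrightarrow> (\<forall>K\<in>M. \<forall>x\<in>interior K. 0 < q x)"

text \<open>The value on the dual cell of an edge of direction \<open>i\<close> (velocities).\<close>

abbreviation edge_val ::
    "'d::finite region set \<Rightarrow> ('d \<Rightarrow> real^'d \<Rightarrow> real) \<Rightarrow> 'd \<Rightarrow> 'd region \<Rightarrow> real" where
  "edge_val M u i \<sigma> \<equiv> val (u i) (dual_cell M i \<sigma>)"


section \<open>Discrete operators\<close>

text \<open>From here on, \<open>q\<close>, \<open>r\<close>, \<open>p\<close> denote families of cell values, and \<open>w\<close> families of edge values,
  \<open>w i \<sigma>\<close> being the value at the edge \<open>\<sigma>\<close> of direction \<open>i\<close>.\<close>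

definition dual_avg ::
    "'d::finite region set \<Rightarrow> ('d region \<Rightarrow> real) \<Rightarrow> 'd \<Rightarrow> 'd region \<Rightarrow> real" where
  "dual_avg M q i \<sigma> =
     (\<Sum>K\<in>adjacent_cells M i \<sigma>. measure lborel (half_cell i \<sigma> K) * q K)
       / measure lborel (dual_cell M i \<sigma>)"

definition discrete_deriv ::
    "'d::finite region \<Rightarrow> 'd region set \<Rightarrow> ('d region \<Rightarrow> real) \<Rightarrow> 'd \<Rightarrow> 'd region \<Rightarrow> real" where
  "discrete_deriv \<Omega> M q i \<sigma> =
     (if \<sigma> \<in> int_edges \<Omega> M i then
        (let K = lower_cell M i \<sigma>; L = neighbour M i \<sigma> K in
          edge_measure i \<sigma> / measure lborel (dual_cell M i \<sigma>) * (q L - q K)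
            * (axis i 1 \<bullet> outward_normal i \<sigma> K))
      else 0)"

definition pos_part :: "real \<Rightarrow> real" where
  "pos_part a = (a + \<bar>a\<bar>) / 2"

definition neg_part :: "real \<Rightarrow> real" where \<comment> \<open>nonpositive\<close>
  "neg_part a = (a - \<bar>a\<bar>) / 2"

definition pressure :: "real \<Rightarrow> real \<Rightarrow> real" where
  "pressure \<gamma> r = r powr \<gamma>"

text \<open>\<open>s\<close> is the stabilisation coefficient \<open>\<eta> \<delta>t / \<epsilon>\<^sup>2\<close>.\<close>

definition delta_u :: "'d::finite region \<Rightarrow> 'd region set \<Rightarrow> real \<Rightarrow> real \<Rightarrow>
    ('d region \<Rightarrow> real) \<Rightarrow> 'd \<Rightarrow> 'd region \<Rightarrow> real" where
  "delta_u \<Omega> M s \<gamma> r i \<sigma> = s * discrete_deriv \<Omega> M (\<lambda>K. pressure \<gamma> (r K)) i \<sigma>"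

definition outward_comp ::
    "('d::finite \<Rightarrow> 'd region \<Rightarrow> real) \<Rightarrow> 'd \<Rightarrow> 'd region \<Rightarrow> 'd region \<Rightarrow> real" where
  "outward_comp w i \<sigma> K = w i \<sigma> * (axis i 1 \<bullet> outward_normal i \<sigma> K)"

text \<open>The stabilised velocity \<open>v = u - \<delta>u\<close> enters the scheme only through these two parts, which
  sum up to \<open>outward_comp v i \<sigma> K\<close> but are not the positive and negative part of that number.\<close>

definition v_plus :: "'d::finite region \<Rightarrow> 'd region set \<Rightarrow> real \<Rightarrow> real \<Rightarrow>
    ('d region \<Rightarrow> real) \<Rightarrow> ('d \<Rightarrow> 'd region \<Rightarrow> real) \<Rightarrow> 'd \<Rightarrow> 'd region \<Rightarrow> 'd region \<Rightarrow> real" where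
  "v_plus \<Omega> M s \<gamma> r w i \<sigma> K =
     pos_part (outward_comp w i \<sigma> K) - neg_part (outward_comp (delta_u \<Omega> M s \<gamma> r) i \<sigma> K)"

definition v_minus :: "'d::finite region \<Rightarrow> 'd region set \<Rightarrow> real \<Rightarrow> real \<Rightarrow>
    ('d region \<Rightarrow> real) \<Rightarrow> ('d \<Rightarrow> 'd region \<Rightarrow> real) \<Rightarrow> 'd \<Rightarrow> 'd region \<Rightarrow> 'd region \<Rightarrow> real" where
  "v_minus \<Omega> M s \<gamma> r w i \<sigma> K =
     neg_part (outward_comp w i \<sigma> K) - pos_part (outward_comp (delta_u \<Omega> M s \<gamma> r) i \<sigma> K)"

definition mass_flux :: "'d::finite region \<Rightarrow> 'd region set \<Rightarrow> real \<Rightarrow> real \<Rightarrow>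
    ('d region \<Rightarrow> real) \<Rightarrow> ('d \<Rightarrow> 'd region \<Rightarrow> real) \<Rightarrow> 'd \<Rightarrow> 'd region \<Rightarrow> 'd region \<Rightarrow> real" where
  "mass_flux \<Omega> M s \<gamma> r w i \<sigma> K =
     (if \<sigma> \<in> int_edges \<Omega> M i then
        edge_measure i \<sigma> * (r K * v_plus \<Omega> M s \<gamma> r w i \<sigma> K
                          + r (neighbour M i \<sigma> K) * v_minus \<Omega> M s \<gamma> r w i \<sigma> K)
      else 0)"

text \<open>Dual flux through the edge \<open>\<epsilon>\<close> of the dual cell of an internal edge \<open>\<sigma>\<close> of direction \<open>i\<close>, where
  \<open>\<epsilon>\<close> is orthogonal to direction \<open>j\<close> and \<open>F\<close> is the family of primal fluxes. For \<open>j \<noteq> i\<close> and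
  \<open>\<sigma> = K|L\<close>, \<open>\<epsilon> \<inter> K\<close> and \<open>\<epsilon> \<inter> L\<close> are the halves of \<open>\<tau>\<close> and \<open>\<tau>'\<close> that make up \<open>\<epsilon>\<close>.\<close>

definition dual_flux :: "'d::finite region \<Rightarrow> 'd region set \<Rightarrow>
    ('d \<Rightarrow> 'd region \<Rightarrow> 'd region \<Rightarrow> real) \<Rightarrow> 'd \<Rightarrow> 'd region \<Rightarrow> 'd \<Rightarrow> 'd region \<Rightarrow> real" where
  "dual_flux \<Omega> M F i \<sigma> j \<epsilon> =
     (if \<epsilon> \<subseteq> frontier \<Omega> then 0
      else if j = i then
        (let K = (THE K. K \<in> adjacent_cells M i \<sigma> \<and> \<epsilon> \<subseteq> K); \<sigma>' = opposite_edge i K \<sigma>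
         in (F i \<sigma>' K - F i \<sigma> K) / 2)
      else
        (let K = lower_cell M i \<sigma>; L = neighbour M i \<sigma> K;
             \<tau> = (THE \<tau>. \<tau> \<in> edges j K \<and> \<epsilon> \<inter> K \<subseteq> \<tau>);
             \<tau>' = (THE \<tau>. \<tau> \<in> edges j L \<and> \<epsilon> \<inter> L \<subseteq> \<tau>)
         in (F j \<tau> K + F j \<tau>' L) / 2))"

text \<open>The edge \<open>\<sigma>'\<close> with \<open>\<epsilon> = D\<^sub>\<sigma>|D\<^sub>\<sigma>\<^sub>'\<close>: its dual cell touches \<open>\<epsilon>\<close> in a set of dimension \<open>d - 1\<close>. At a
  reentrant corner of the domain, the dual cell of \<open>\<sigma>'\<close> may touch one half of \<open>\<epsilon>\<close> only (then \<open>\<sigma>'\<close> is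
  external). If \<open>\<epsilon>\<close> lies on the boundary, there is no such edge, but then the dual flux vanishes.\<close>

definition dual_neighbour ::
    "'d::finite region set \<Rightarrow> 'd \<Rightarrow> 'd region \<Rightarrow> 'd region \<Rightarrow> 'd region" where
  "dual_neighbour M i \<sigma> \<epsilon> = (THE \<sigma>'. \<sigma>' \<in> mesh_edges M i \<and> \<sigma>' \<noteq> \<sigma> \<and>
     aff_dim (\<epsilon> \<inter> dual_cell M i \<sigma>') = int CARD('d) - 1)"

definition upwind_val :: "'d::finite region \<Rightarrow> 'd region set \<Rightarrow>
    ('d \<Rightarrow> 'd region \<Rightarrow> 'd region \<Rightarrow> real) \<Rightarrow> ('d \<Rightarrow> 'd region \<Rightarrow> real) \<Rightarrow>
    'd \<Rightarrow> 'd region \<Rightarrow> 'd \<Rightarrow> 'd region \<Rightarrow> real" where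
  "upwind_val \<Omega> M F w i \<sigma> j \<epsilon> =
     (if 0 \<le> dual_flux \<Omega> M F i \<sigma> j \<epsilon> then w i \<sigma> else w i (dual_neighbour M i \<sigma> \<epsilon>))"


section \<open>The semi-implicit scheme\<close>

definition mass_balance :: "'d::finite region \<Rightarrow> 'd region set \<Rightarrow>
    real \<Rightarrow> real \<Rightarrow> real \<Rightarrow> real \<Rightarrow> (real^'d \<Rightarrow> real) \<Rightarrow> ('d \<Rightarrow> real^'d \<Rightarrow> real) \<Rightarrow>
    (real^'d \<Rightarrow> real) \<Rightarrow> bool" where
  "mass_balance \<Omega> M eps \<gamma> \<eta> dt \<rho>\<^sub>0 u\<^sub>0 \<rho>\<^sub>1 \<longleftrightarrow>
     (let F = mass_flux \<Omega> M (\<eta> * dt / eps\<^sup>2) \<gamma> (val \<rho>\<^sub>1) (edge_val M u\<^sub>0) in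
      \<forall>K\<in>M. 1 / dt * (val \<rho>\<^sub>1 K - val \<rho>\<^sub>0 K)
              + 1 / measure lborel K * (\<Sum>i\<in>UNIV. \<Sum>\<sigma>\<in>edges i K. F i \<sigma> K) = 0)"

definition momentum_balance :: "'d::finite region \<Rightarrow> 'd region set \<Rightarrow>
    real \<Rightarrow> real \<Rightarrow> real \<Rightarrow> real \<Rightarrow> (real^'d \<Rightarrow> real) \<Rightarrow> ('d \<Rightarrow> real^'d \<Rightarrow> real) \<Rightarrow>
    (real^'d \<Rightarrow> real) \<Rightarrow> ('d \<Rightarrow> real^'d \<Rightarrow> real) \<Rightarrow> bool" where
  "momentum_balance \<Omega> M eps \<gamma> \<eta> dt \<rho>\<^sub>0 u\<^sub>0 \<rho>\<^sub>1 u\<^sub>1 \<longleftrightarrow>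
     (let F = mass_flux \<Omega> M (\<eta> * dt / eps\<^sup>2) \<gamma> (val \<rho>\<^sub>1) (edge_val M u\<^sub>0) in
      \<forall>i. \<forall>\<sigma>\<in>int_edges \<Omega> M i.
        1 / dt * (dual_avg M (val \<rho>\<^sub>1) i \<sigma> * edge_val M u\<^sub>1 i \<sigma>
                  - dual_avg M (val \<rho>\<^sub>0) i \<sigma> * edge_val M u\<^sub>0 i \<sigma>)
        + 1 / measure lborel (dual_cell M i \<sigma>)
            * (\<Sum>j\<in>UNIV. \<Sum>\<epsilon>\<in>edges j (dual_cell M i \<sigma>).
                 dual_flux \<Omega> M F i \<sigma> j \<epsilon> * upwind_val \<Omega> M F (edge_val M u\<^sub>0) i \<sigma> j \<epsilon>)
        + 1 / eps\<^sup>2 * discrete_deriv \<Omega> M (\<lambda>K. pressure \<gamma> (val \<rho>\<^sub>1 K)) i \<sigma> = 0)"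

end

theory Submission
  imports Defs
begin

text \<open>Only the mass balance is implicit: once \<open>\<rho>\<^sub>1 > 0\<close> is known, the momentum balance is solved for
  \<open>u\<^sub>1\<close> edge by edge. The mass flux through \<open>K|L\<close> is conservative, nondecreasing in \<open>r K\<close> and
  nonincreasing in \<open>r L\<close>, because the pressure stabilisation is upwinded too. So a damped Jacobi iteration
  with a small step is monotone on a bounded range of densities (\<open>\<gamma> \<ge> 1\<close> makes the pressure Lipschitz
  there). Started from \<open>0\<close>, it increases, and it stays bounded because conservation bounds the total mass.
  Its limit solves the mass balance; the limit is positive, since a cell with density \<open>0\<close> has only
  inflow.\<close>


section \<open>Conservative monotone schemes\<close>

text \<open>The obstacle is a circle: for \<open>\<gamma> > 1\<close> the pressure has no global
  Lipschitz constant, so a step size that makes the iteration monotone presupposes a bound on the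
  densities. Conservation breaks the circle: the bound on the total mass depends on the data alone,
  so the range \<open>[0, R]\<close>, the Lipschitz constant on it and the step are fixed before the
  iteration starts. The hypothesis \<open>one_sided_lipschitz\<close> combines two facts. For
  \<open>r' K = r K\<close> it says that raising the other densities cannot raise the net outflow of
  \<open>K\<close>; in general it limits how fast this outflow grows with \<open>r K\<close>. The
  main fact about the grid is that an internal edge belongs to exactly two cells, lying on opposite
  sides of it. It gives the definite descriptions in \<open>neighbour\<close> and
  \<open>lower_cell\<close> their meaning and makes the fluxes cancel in pairs.\<close>

lemma conservative_scheme_has_positive_solution:
  fixes \<Phi> :: "'k \<Rightarrow> ('k \<Rightarrow> real) \<Rightarrow> real" and c b :: "'k \<Rightarrow> real"
  assumes fin: "finite M"
    and c: "\<And>K. K \<in> M \<Longrightarrow> 0 < c K"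
    and b: "\<And>K. K \<in> M \<Longrightarrow> 0 < b K"
    and conservative: "\<And>r. (\<And>K. 0 \<le> r K) \<Longrightarrow> (\<Sum>K\<in>M. \<Phi> K r) = 0"
    and one_sided_lipschitz: "\<And>R. \<exists>\<Lambda>. \<forall>K\<in>M. \<forall>r r'.
      (\<forall>L. 0 \<le> r L \<and> r L \<le> r' L \<and> r' L \<le> R) \<longrightarrow> \<Phi> K r' - \<Phi> K r \<le> \<Lambda> * (r' K - r K)"
    and continuous: "\<And>K r s. \<lbrakk>K \<in> M; \<And>n L. 0 \<le> r n L; \<And>L. (\<lambda>n. r n L) \<longlonglongrightarrow> s L\<rbrakk>
      \<Longrightarrow> (\<lambda>n. \<Phi> K (r n)) \<longlonglongrightarrow> \<Phi> K s"
    and inflow: "\<And>K r. \<lbrakk>K \<in> M; \<And>L. 0 \<le> r L; r K = 0\<rbrakk> \<Longrightarrow> \<Phi> K r \<le> 0"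
  shows "\<exists>r. \<forall>K\<in>M. 0 < r K \<and> c K * (r K - b K) + \<Phi> K r = 0"
proof -
  \<comment> \<open>\<open>m\<close> is the total mass of the old densities. A mass of at most
    \<open>m\<close> forces \<open>r K \<le> m / c K\<close>; \<open>R\<close> adds up these bounds,
    so that one number serves every cell, also when \<open>M\<close> is empty.\<close>
  define m where "m = (\<Sum>K\<in>M. c K * b K)"
  define R where "R = (\<Sum>K\<in>M. m / c K)"
  have m0: "0 \<le> m"
    unfolding m_def using b c by (meson less_eq_real_def mult_nonneg_nonneg sum_nonneg)
  have R: "m / c K \<le> R" if "K \<in> M" for K
    unfolding R_def using fin that m0 c by (intro member_le_sum) (auto simp: less_imp_le)
  have R0: "0 \<le> R"
    unfolding R_def using m0 c by (intro sum_nonneg) (auto simp: less_imp_le)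
  obtain \<Lambda>0 where \<Lambda>0: "\<And>K r r'. \<lbrakk>K \<in> M; \<And>L. 0 \<le> r L \<and> r L \<le> r' L \<and> r' L \<le> R\<rbrakk>
      \<Longrightarrow> \<Phi> K r' - \<Phi> K r \<le> \<Lambda>0 * (r' K - r K)"
    using one_sided_lipschitz[of R] by metis
  define \<Lambda> where "\<Lambda> = \<bar>\<Lambda>0\<bar>"
  have lip: "\<Phi> K r' - \<Phi> K r \<le> \<Lambda> * (r' K - r K)"
    if "K \<in> M" "\<And>L. 0 \<le> r L \<and> r L \<le> r' L \<and> r' L \<le> R" for K r r'
  proof -
    have "\<Lambda>0 * (r' K - r K) \<le> \<Lambda> * (r' K - r K)"
      using that(2)[of K] by (intro mult_right_mono) (auto simp: \<Lambda>_def)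
    then show ?thesis using \<Lambda>0[of K r r', OF that] by linarith
  qed
  \<comment> \<open>Monotonicity asks for \<open>\<theta> * (1 + \<Lambda> / c K) \<le> 1\<close> in
    every cell: then the increment of \<open>\<theta> / c K * res r K\<close> never exceeds that of
    \<open>r K\<close>. The sum is a common bound for the quotients
    \<open>\<Lambda> / c K\<close>.\<close>
  define \<theta> where "\<theta> = 1 / (1 + (\<Sum>K\<in>M. \<Lambda> / c K))"
  have cS: "\<Lambda> / c K \<le> (\<Sum>K\<in>M. \<Lambda> / c K)" if "K \<in> M" for K
    using fin that c by (intro member_le_sum) (auto simp: less_imp_le \<Lambda>_def)
  have S0: "0 \<le> (\<Sum>K\<in>M. \<Lambda> / c K)" using c by (simp add: less_imp_le sum_nonneg \<Lambda>_def)
  have \<theta>0: "0 < \<theta>" and \<theta>1: "\<theta> \<le> 1" using S0 by (simp_all add: \<theta>_def)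
  have \<theta>: "\<theta> * (1 + \<Lambda> / c K) \<le> 1" if "K \<in> M" for K
    using mult_left_mono[of "1 + \<Lambda> / c K" "1 + (\<Sum>K\<in>M. \<Lambda> / c K)" \<theta>] cS[OF that] S0 \<theta>0
    by (simp add: \<theta>_def)
  define res where "res = (\<lambda>r K. c K * (r K - b K) + \<Phi> K r)"
  \<comment> \<open>The value \<open>0\<close> off \<open>M\<close> keeps the iterates nonnegative,
    bounded and convergent at every argument, since the hypotheses on \<open>\<Phi>\<close> quantify
    over the whole index type.\<close>
  define G where "G = (\<lambda>r K. if K \<in> M then r K - \<theta> / c K * res r K else 0)"
  define x where "x = (\<lambda>n. (G ^^ n) (\<lambda>_. 0))"
  have x0: "x 0 = (\<lambda>_. 0)" and xS: "x (Suc n) = G (x n)" for n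
    by (simp_all add: x_def)
  have mono: "G r K \<le> G r' K" if "\<And>L. 0 \<le> r L \<and> r L \<le> r' L \<and> r' L \<le> R" for r r' K
  proof (cases "K \<in> M")
    case True
    note cK = c[OF True]
    have "\<theta> / c K * (res r' K - res r K) = \<theta> / c K * (\<Phi> K r' - \<Phi> K r + c K * (r' K - r K))"
      by (simp add: res_def algebra_simps)
    also have "\<dots> \<le> \<theta> / c K * ((c K + \<Lambda>) * (r' K - r K))"
      using lip[of K r r', OF True that] \<theta>0 cK by (intro mult_left_mono) (auto simp: algebra_simps)
    also have "\<dots> = \<theta> * (1 + \<Lambda> / c K) * (r' K - r K)"
      using cK by (simp add: field_simps)
    also have "\<dots> \<le> 1 * (r' K - r K)"
      using \<theta>[OF True] that[of K] by (intro mult_right_mono) auto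
    finally show ?thesis using True by (simp add: G_def algebra_simps)
  qed (simp add: G_def)
  have bound: "r K \<le> R"
    if "(\<Sum>K\<in>M. c K * r K) \<le> m" "\<And>L. 0 \<le> r L" "\<And>L. L \<notin> M \<Longrightarrow> r L = 0" for r K
  proof (cases "K \<in> M")
    case True
    have "c K * r K \<le> (\<Sum>K\<in>M. c K * r K)"
      using fin True c that by (intro member_le_sum[of K M "\<lambda>K. c K * r K"]) (auto simp: less_imp_le)
    then have "r K \<le> m / c K" using that c[OF True] by (simp add: field_simps)
    then show ?thesis using R[OF True] by simp
  qed (use that R0 in simp)
  \<comment> \<open>The fluxes cancel in the sum, so the new mass is \<open>1 - \<theta>\<close>
    times the old one plus \<open>\<theta> * m\<close>.\<close>
  have mass: "(\<Sum>K\<in>M. c K * G r K) \<le> m"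
    if "(\<Sum>K\<in>M. c K * r K) \<le> m" "\<And>L. 0 \<le> r L" for r
  proof -
    have "(\<Sum>K\<in>M. c K * G r K) = (\<Sum>K\<in>M. c K * r K - \<theta> * (c K * r K - c K * b K + \<Phi> K r))"
    proof (intro sum.cong refl)
      fix K assume "K \<in> M"
      then show "c K * G r K = c K * r K - \<theta> * (c K * r K - c K * b K + \<Phi> K r)"
        using c[of K] by (simp add: G_def res_def field_simps)
    qed
    also have "\<dots> = (\<Sum>K\<in>M. c K * r K) - \<theta> * ((\<Sum>K\<in>M. c K * r K) - m + (\<Sum>K\<in>M. \<Phi> K r))"
      by (simp add: m_def sum_subtractf sum.distrib sum_distrib_left algebra_simps)
    also have "\<dots> \<le> m"
      using mult_right_mono[of \<theta> 1 "m - (\<Sum>K\<in>M. c K * r K)"] \<theta>1 that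
      by (simp add: conservative algebra_simps)
    finally show ?thesis .
  qed
  \<comment> \<open>The claims need each other: \<open>mono\<close> applies only below
    \<open>R\<close>, and the bound by \<open>R\<close> comes from the mass estimate, which asks for
    nonnegative iterates.\<close>
  have inv: "(\<forall>K. 0 \<le> x n K \<and> x n K \<le> R \<and> x n K \<le> x (Suc n) K) \<and>
      (\<forall>K. K \<notin> M \<longrightarrow> x n K = 0) \<and> (\<Sum>K\<in>M. c K * x n K) \<le> m" for n
  proof (induction n)
    case 0
    \<comment> \<open>At density zero \<open>inflow\<close> makes the flux term nonpositive, so the
      residual is at most \<open>- c K * b K\<close> and the first step goes up.\<close>
    have "0 \<le> G (\<lambda>_. 0) K" for K
    proof (cases "K \<in> M")
      case True
      have "\<theta> / c K * res (\<lambda>_. 0) K \<le> 0"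
        using inflow[OF True, of "\<lambda>_. 0"] c[OF True] \<theta>0
          mult_pos_pos[OF c[OF True] b[OF True]]
        by (intro mult_nonneg_nonpos) (auto simp: res_def)
      then show ?thesis using True by (simp add: G_def)
    qed (simp add: G_def)
    then show ?case using m0 R0 by (simp add: x0 xS)
  next
    case (Suc n)
    have nonneg: "0 \<le> x (Suc n) K" for K using Suc by (meson order_trans)
    have zero: "x (Suc n) K = 0" if "K \<notin> M" for K using that by (simp add: xS G_def)
    have W: "(\<Sum>K\<in>M. c K * x (Suc n) K) \<le> m"
      unfolding xS using Suc by (intro mass) auto
    have R: "x (Suc n) K \<le> R" for K using bound[OF W nonneg zero] .
    have "x (Suc n) K \<le> x (Suc (Suc n)) K" for K
      unfolding xS[of "Suc n"] using Suc nonneg R by (subst xS) (intro mono, auto)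
    then show ?case using nonneg zero W R by blast
  qed
  have "\<exists>l. (\<lambda>n. x n K) \<longlonglongrightarrow> l" for K
  proof -
    have "incseq (\<lambda>n. x n K)" using inv by (intro incseq_SucI) blast
    then show ?thesis using incseq_convergent[of "\<lambda>n. x n K" R] inv by metis
  qed
  then obtain s where s: "\<And>K. (\<lambda>n. x n K) \<longlonglongrightarrow> s K" by metis
  have s0: "0 \<le> s K" for K
    using s inv by (intro LIMSEQ_le_const[OF s]) auto
  have eq: "res s K = 0" if K: "K \<in> M" for K
  proof -
    have "(\<lambda>n. \<Phi> K (x n)) \<longlonglongrightarrow> \<Phi> K s" using inv by (intro continuous[OF K] s) auto
    then have "(\<lambda>n. x n K - \<theta> / c K * res (x n) K) \<longlonglongrightarrow> s K - \<theta> / c K * res s K"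
      unfolding res_def by (intro tendsto_intros s)
    \<comment> \<open>This sequence is \<open>x (Suc n) K\<close>, which has the same limit as
      \<open>x n K\<close>; comparing the limits leaves
      \<open>\<theta> / c K * res s K = 0\<close>.\<close>
    moreover have "(\<lambda>n. x n K - \<theta> / c K * res (x n) K) \<longlonglongrightarrow> s K"
      using LIMSEQ_Suc[OF s[of K]] K by (simp add: xS G_def)
    ultimately show ?thesis using LIMSEQ_unique c[OF K] \<theta>0 by fastforce
  qed
  have "0 < s K" if K: "K \<in> M" for K
  proof (rule ccontr)
    assume "\<not> 0 < s K"
    then have "s K = 0" using s0[of K] by simp
    then have "res s K \<le> - (c K * b K)" using inflow[OF K s0] by (simp add: res_def)
    then show False using eq[OF K] b[OF K] c[OF K] mult_pos_pos[of "c K" "b K"] by linarith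
  qed
  then show ?thesis using eq unfolding res_def by blast
qed


section \<open>The upwind flux\<close>

text \<open>The flux from a cell of density \<open>x\<close> to one of density \<open>y\<close>
  through an edge of measure \<open>E\<close>. The outward given velocity is \<open>a\<close>, and
  \<open>k * (y powr \<gamma> - x powr \<gamma>)\<close> is the outward component of the pressure
  correction. The geometry is confined to \<open>E\<close>, \<open>k\<close> and
  \<open>a\<close>.\<close>

definition upwind_flux :: "real \<Rightarrow> real \<Rightarrow> real \<Rightarrow> real \<Rightarrow> real \<Rightarrow> real \<Rightarrow> real" where
  "upwind_flux E k \<gamma> a x y =
     E * (x * (pos_part a - neg_part (k * (y powr \<gamma> - x powr \<gamma>)))
        + y * (neg_part a - pos_part (k * (y powr \<gamma> - x powr \<gamma>))))"

lemma pos_part_eq_max: "pos_part a = max a 0" and neg_part_eq_min: "neg_part a = min a 0"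
  by (auto simp: pos_part_def neg_part_def)

lemma pos_part_minus: "pos_part (- a) = - neg_part a"
  and neg_part_minus: "neg_part (- a) = - pos_part a"
  by (simp_all add: pos_part_eq_max neg_part_eq_min max_def min_def)

text \<open>Seen from the other cell, the normal is reversed and the densities trade places. This is
  the source of conservation.\<close>

lemma upwind_flux_antisym: "upwind_flux E k \<gamma> (- a) y x = - upwind_flux E k \<gamma> a x y"
proof -
  have "k * (x powr \<gamma> - y powr \<gamma>) = - (k * (y powr \<gamma> - x powr \<gamma>))" by (simp add: algebra_simps)
  then show ?thesis
    by (simp only: upwind_flux_def pos_part_minus neg_part_minus) (simp add: algebra_simps)
qed

lemma upwind_flux_inflow: "0 \<le> E \<Longrightarrow> 0 \<le> y \<Longrightarrow> upwind_flux E k \<gamma> a 0 y \<le> 0"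
  unfolding upwind_flux_def pos_part_eq_max neg_part_eq_min
  by (auto intro!: mult_nonneg_nonpos)

text \<open>The exponent is positive and the bases are nonnegative, so \<open>powr\<close> is
  continuous even where a density tends to \<open>0\<close>.\<close>

lemma tendsto_upwind_flux:
  assumes "0 < \<gamma>" "X \<longlonglongrightarrow> x" "Y \<longlonglongrightarrow> y" "\<And>n. 0 \<le> X n" "\<And>n. 0 \<le> Y n"
  shows "(\<lambda>n. upwind_flux E k \<gamma> a (X n) (Y n)) \<longlonglongrightarrow> upwind_flux E k \<gamma> a x y"
  unfolding upwind_flux_def pos_part_def neg_part_def
  using assms by (intro tendsto_intros tendsto_powr2) auto

text \<open>The mean value theorem takes the derivative only at a point \<open>z\<close> strictly
  between \<open>x\<close> and \<open>x'\<close>, which admits \<open>x = 0\<close>. As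
  \<open>\<gamma> \<ge> 1\<close>, the derivative at \<open>z\<close> is at most its value at
  \<open>R\<close>.\<close>

lemma powr_lipschitz:
  fixes \<gamma> :: real
  assumes "1 \<le> \<gamma>" "0 \<le> x" "x \<le> x'" "x' \<le> R"
  shows "x' powr \<gamma> - x powr \<gamma> \<le> \<gamma> * R powr (\<gamma> - 1) * (x' - x)"
proof (cases "x = x'")
  case False
  then have "x < x'" using assms by simp
  moreover have "continuous_on {x..x'} (\<lambda>t. t powr \<gamma>)"
    using assms by (intro continuous_on_powr' continuous_intros) auto
  moreover have deriv: "((\<lambda>t. t powr \<gamma>) has_real_derivative \<gamma> * z powr (\<gamma> - 1)) (at z)"
    if "x < z" for z
    using that assms by (intro has_real_derivative_powr) auto
  ultimately obtain l z where z: "x < z" "z < x'"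
    and l: "((\<lambda>t. t powr \<gamma>) has_real_derivative l) (at z)"
    and eq: "x' powr \<gamma> - x powr \<gamma> = (x' - x) * l"
    using MVT[of x x' "\<lambda>t. t powr \<gamma>"] real_differentiable_def by blast
  have "l = \<gamma> * z powr (\<gamma> - 1)" using DERIV_unique[OF l deriv[OF z(1)]] .
  note eq = eq[unfolded this]
  have "z powr (\<gamma> - 1) \<le> R powr (\<gamma> - 1)"
    using z assms by (intro powr_mono2) auto
  then have "(x' - x) * (\<gamma> * z powr (\<gamma> - 1)) \<le> (x' - x) * (\<gamma> * R powr (\<gamma> - 1))"
    using z assms by (intro mult_left_mono) auto
  then show ?thesis using eq by (simp add: mult_ac)
qed simp

text \<open>Raising \<open>y\<close> only lowers the flux, so the bound involves
  \<open>x' - x\<close> alone. In the constant, \<open>\<bar>a\<bar>\<close> stems from the given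
  velocity and \<open>k * R powr \<gamma>\<close> from the growth of the factor \<open>x\<close> in
  the stabilising outflow. The growth of the pressure of \<open>x\<close> enters twice, once in the
  stabilising outflow and once in the stabilising inflow.\<close>

lemma upwind_flux_one_sided_lipschitz:
  assumes "1 \<le> \<gamma>" "0 \<le> E" "0 \<le> k" "0 \<le> x" "x \<le> x'" "x' \<le> R" "0 \<le> y" "y \<le> y'" "y' \<le> R"
  shows "upwind_flux E k \<gamma> a x' y' - upwind_flux E k \<gamma> a x y
    \<le> E * (\<bar>a\<bar> + k * R powr \<gamma> + 2 * k * R * (\<gamma> * R powr (\<gamma> - 1))) * (x' - x)"
proof -
  define D where "D = \<gamma> * R powr (\<gamma> - 1)"
  define X X' Y Y' where "X = k * x powr \<gamma>" and "X' = k * x' powr \<gamma>"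
    and "Y = k * y powr \<gamma>" and "Y' = k * y' powr \<gamma>"
  have *: "0 \<le> X" "X \<le> X'" "X' \<le> k * R powr \<gamma>" "0 \<le> Y" "Y \<le> Y'"
    using assms by (auto simp: X_def X'_def Y_def Y'_def intro!: mult_left_mono powr_mono2)
  have dX: "X' - X \<le> k * D * (x' - x)"
    using mult_left_mono[OF powr_lipschitz[of \<gamma> x x' R] \<open>0 \<le> k\<close>] assms
    by (simp add: X_def X'_def D_def algebra_simps)
  have dX0: "0 \<le> k * D * (x' - x)" using dX * by linarith
  have a: "x' * pos_part a - x * pos_part a \<le> \<bar>a\<bar> * (x' - x)"
  proof -
    have "pos_part a * (x' - x) \<le> \<bar>a\<bar> * (x' - x)"
      using assms by (intro mult_right_mono) (auto simp: pos_part_eq_max)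
    then show ?thesis by (simp add: algebra_simps)
  qed
  have b: "y' * neg_part a - y * neg_part a \<le> 0"
    using mult_nonneg_nonpos[of "y' - y" "neg_part a"] assms
    by (simp add: neg_part_eq_min left_diff_distrib)
  \<comment> \<open>Three moves lead from the primed to the unprimed values: \<open>Y'\<close> is
    lowered to \<open>Y\<close>, then the factor \<open>x'\<close> to \<open>x\<close>, then
    \<open>X'\<close> to \<open>X\<close>. Only the last two cost anything.\<close>
  have c: "x' * max (X' - Y') 0 - x * max (X - Y) 0 \<le> (k * R powr \<gamma> + k * R * D) * (x' - x)"
  proof -
    have "x' * max (X' - Y') 0 \<le> x' * max (X' - Y) 0"
      using * assms by (intro mult_left_mono) auto
    moreover have "(x' - x) * max (X' - Y) 0 \<le> (x' - x) * (k * R powr \<gamma>)"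
      using * assms by (intro mult_left_mono) auto
    moreover have "x * (max (X' - Y) 0 - max (X - Y) 0) \<le> x * (k * D * (x' - x))"
      using * assms dX dX0 by (intro mult_left_mono) auto
    moreover have "x * (k * D * (x' - x)) \<le> R * (k * D * (x' - x))"
      using assms dX0 by (intro mult_right_mono) auto
    ultimately show ?thesis by (simp add: algebra_simps)
  qed
  have d: "y * max (Y - X) 0 - y' * max (Y' - X') 0 \<le> k * R * D * (x' - x)"
  proof -
    have "y * max (Y - X') 0 \<le> y' * max (Y' - X') 0"
      using * assms by (intro mult_mono) auto
    moreover have "y * (max (Y - X) 0 - max (Y - X') 0) \<le> y * (k * D * (x' - x))"
      using * assms dX dX0 by (intro mult_left_mono) auto
    moreover have "y * (k * D * (x' - x)) \<le> R * (k * D * (x' - x))"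
      using assms dX0 by (intro mult_right_mono) auto
    ultimately show ?thesis by (simp add: algebra_simps)
  qed
  \<comment> \<open>The flux consists of two convection terms, the stabilising outflow and the
    stabilising inflow; the facts \<open>a\<close>, \<open>b\<close>, \<open>c\<close>,
    \<open>d\<close> bound their increments in this order.\<close>
  have e: "upwind_flux E k \<gamma> a u v = E * (u * pos_part a + v * neg_part a
      + u * max (k * u powr \<gamma> - k * v powr \<gamma>) 0 - v * max (k * v powr \<gamma> - k * u powr \<gamma>) 0)" for u v
  proof -
    have "neg_part (k * (v powr \<gamma> - u powr \<gamma>)) = - max (k * u powr \<gamma> - k * v powr \<gamma>) 0"
      "pos_part (k * (v powr \<gamma> - u powr \<gamma>)) = max (k * v powr \<gamma> - k * u powr \<gamma>) 0"
      by (auto simp: pos_part_eq_max neg_part_eq_min right_diff_distrib)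
    then show ?thesis by (simp add: upwind_flux_def algebra_simps)
  qed
  have "upwind_flux E k \<gamma> a x' y' - upwind_flux E k \<gamma> a x y
    = E * ((x' * pos_part a - x * pos_part a) + (y' * neg_part a - y * neg_part a)
       + (x' * max (X' - Y') 0 - x * max (X - Y) 0) + (y * max (Y - X) 0 - y' * max (Y' - X') 0))"
    unfolding e X_def X'_def Y_def Y'_def by (simp add: right_diff_distrib distrib_left)
  also have "\<dots> \<le> E * (\<bar>a\<bar> * (x' - x) + 0
       + (k * R powr \<gamma> + k * R * D) * (x' - x) + k * R * D * (x' - x))"
    using a b c d assms by (intro mult_left_mono add_mono) auto
  finally show ?thesis by (simp add: D_def algebra_simps)
qed


section \<open>Internal edges separate two cells\<close>

lemma mac_grid_cell:
  fixes K :: "(real^'d::finite) set"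
  assumes "mac_grid \<Omega> M" "K \<in> M"
  shows "K = cbox (interval_lowerbound K) (interval_upperbound K)" "lo K i < hi K i"
proof -
  have "M division_of closure \<Omega>" and ne: "interior K \<noteq> {}"
    using assms by (simp_all add: mac_grid_def)
  then have "\<exists>a b. K = cbox a b" using division_ofD(4) assms(2) by blast
  then obtain a b where K: "K = cbox a b" by blast
  have ab: "a $ j < b $ j" for j
    using ne by (simp add: K interior_cbox interval_ne_empty_cart)
  have "cbox a b \<noteq> {}"
    using ab by (simp add: interval_ne_empty_cart less_imp_le)
  then have "interval_lowerbound K = a" "interval_upperbound K = b"
    unfolding K by (rule interval_bounds')+
  note bounds = this
  show "K = cbox (interval_lowerbound K) (interval_upperbound K)"
    unfolding bounds by (rule K)
  show "lo K i < hi K i"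
    unfolding bounds by (rule ab)
qed

lemma mem_cell:
  assumes "mac_grid \<Omega> M" "K \<in> M"
  shows "x \<in> K \<longleftrightarrow> (\<forall>i. lo K i \<le> x $ i \<and> x $ i \<le> hi K i)"
  using arg_cong[OF mac_grid_cell(1)[OF assms], of "\<lambda>A. x \<in> A"] unfolding mem_box_cart .

lemma mem_interior_cell:
  assumes "mac_grid \<Omega> M" "K \<in> M"
  shows "x \<in> interior K \<longleftrightarrow> (\<forall>i. lo K i < x $ i \<and> x $ i < hi K i)"
  using arg_cong[OF mac_grid_cell(1)[OF assms], of "\<lambda>A. x \<in> interior A"]
  unfolding interior_cbox mem_box_cart .

lemma mac_grid_interior_disjoint:
  assumes "mac_grid \<Omega> M" "K \<in> M" "L \<in> M" "K \<noteq> L"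
  shows "interior K \<inter> interior L = {}"
  using assms unfolding mac_grid_def division_of_def by blast

lemma mac_grid_closed: "mac_grid \<Omega> M \<Longrightarrow> K \<in> M \<Longrightarrow> closed K"
  using arg_cong[OF mac_grid_cell(1), of \<Omega> M K closed] closed_cbox by blast

lemma mac_grid_finite: "mac_grid \<Omega> M \<Longrightarrow> finite M"
  unfolding mac_grid_def division_of_def by blast

lemma mac_grid_interior_nonempty: "mac_grid \<Omega> M \<Longrightarrow> K \<in> M \<Longrightarrow> interior K \<noteq> {}"
  unfolding mac_grid_def by blast

text \<open>Every point of the side of the cell \<open>K\<close> at \<open>x $ i = c\<close> can be joined to the interior point \<open>y\<close> of
  that side by a segment that continues beyond \<open>y\<close>.\<close>

lemma cell_side_subset_face:
  assumes grid: "mac_grid \<Omega> M" "K \<in> M"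
    and face: "T face_of K" and y: "y \<in> T" "y $ i = c"
    and strict: "\<And>j. j \<noteq> i \<Longrightarrow> lo K j < y $ j \<and> y $ j < hi K j"
  shows "{x\<in>K. x $ i = c} \<subseteq> T"
proof
  fix x assume x: "x \<in> {x\<in>K. x $ i = c}"
  have yK: "y \<in> K" using y face face_of_imp_subset by blast
  show "x \<in> T"
  proof (cases "x = y")
    case False
    define g where "g = (\<lambda>t::real. y + t *\<^sub>R (y - x))"
    have "\<forall>\<^sub>F t in at_right 0. \<forall>j\<in>UNIV - {i}. lo K j < g t $ j \<and> g t $ j < hi K j"
    proof (intro eventually_ball_finite ballI eventually_conj)
      fix j assume "j \<in> UNIV - {i}"
      then have *: "lo K j < y $ j" "y $ j < hi K j" using strict by auto
      have lim: "((\<lambda>t. g t $ j) \<longlongrightarrow> y $ j) (at_right 0)"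
        unfolding g_def by (auto intro!: tendsto_eq_intros)
      show "\<forall>\<^sub>F t in at_right 0. lo K j < g t $ j" "\<forall>\<^sub>F t in at_right 0. g t $ j < hi K j"
        using order_tendstoD[OF lim] * by blast+
    qed simp
    then have "\<forall>\<^sub>F t in at_right 0. 0 < t \<and> (\<forall>j\<in>UNIV - {i}. lo K j < g t $ j \<and> g t $ j < hi K j)"
      using eventually_conj[OF eventually_at_right_less[of "0::real"]] by blast
    from eventually_happens'[OF trivial_limit_at_right_real this]
    obtain t where t: "0 < t" "\<And>j. j \<noteq> i \<Longrightarrow> lo K j < g t $ j \<and> g t $ j < hi K j"
      by blast
    have "lo K j \<le> g t $ j \<and> g t $ j \<le> hi K j" for j
    proof (cases "j = i")
      case True
      then have "g t $ j = y $ j" using x y by (simp add: g_def)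
      then show ?thesis using yK unfolding mem_cell[OF grid] by simp
    qed (use t(2)[of j] in auto)
    then have gK: "g t \<in> K" unfolding mem_cell[OF grid] by simp
    \<comment> \<open>The weight \<open>1 / (1 + t)\<close> results from solving
      \<open>g t = y + t *\<^sub>R (y - x)\<close> for \<open>y\<close>.\<close>
    have "y = (1 - 1 / (1 + t)) *\<^sub>R x + (1 / (1 + t)) *\<^sub>R g t"
    proof -
      have "t *\<^sub>R x + g t = (1 + t) *\<^sub>R y" by (simp add: g_def algebra_simps)
      then have "y = (1 / (1 + t)) *\<^sub>R (t *\<^sub>R x + g t)" using t(1) by simp
      moreover have "1 - 1 / (1 + t) = t / (1 + t)" using t(1) by (simp add: field_simps)
      ultimately show ?thesis by (simp add: scaleR_add_right)
    qed
    moreover have "x \<noteq> g t"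
    proof
      assume "x = g t"
      then have "(1 + t) *\<^sub>R (y - x) = 0" by (simp add: g_def algebra_simps)
      then show False using t(1) False by simp
    qed
    ultimately have "y \<in> open_segment x (g t)"
      using t(1) unfolding in_segment by (intro conjI exI[of _ "1 / (1 + t)"]) auto
    then show ?thesis using face_ofD[OF face] x gK y by blast
  qed (use y in blast)
qed

section \<open>Edges as sides of boxes\<close>

lemma edges_eq:
  "\<sigma> \<in> edges i K \<longleftrightarrow> (\<exists>c\<in>{lo K i, hi K i}. \<sigma> = {x\<in>K. x $ i = c})"
  by (auto simp: edges_def lower_edge_def upper_edge_def)

lemma lower_edge_nonempty: "lower_edge i K \<noteq> {}" and upper_edge_nonempty: "upper_edge i K \<noteq> {}"
  if "mac_grid \<Omega> M" "K \<in> M"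
proof -
  have "interval_lowerbound K \<in> lower_edge i K" "interval_upperbound K \<in> upper_edge i K"
    using mac_grid_cell(2)[OF that]
    by (auto simp: lower_edge_def upper_edge_def mem_cell[OF that] less_imp_le)
  then show "lower_edge i K \<noteq> {}" "upper_edge i K \<noteq> {}" by auto
qed

lemma edge_of_cell:
  assumes "mac_grid \<Omega> M" "K \<in> M" "\<sigma> \<in> edges i K"
  obtains c where "c \<in> {lo K i, hi K i}" "\<sigma> = {x\<in>K. x $ i = c}" "lo K i \<le> c" "c \<le> hi K i"
  using assms(3) mac_grid_cell(2)[OF assms(1,2), of i] by (fastforce simp: edges_eq)

text \<open>All the bounds are read off at two opposite corners of the side, \<open>p\<close> and
  \<open>q\<close>.\<close>

lemma cell_side_bounds:
  assumes K: "mac_grid \<Omega> M" "K \<in> M" and L: "mac_grid \<Omega> M" "L \<in> M"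
    and c: "lo K i \<le> c" "c \<le> hi K i" and sub: "{x\<in>K. x $ i = c} \<subseteq> L"
  shows "lo L i \<le> c" "c \<le> hi L i" and "j \<noteq> i \<Longrightarrow> lo L j \<le> lo K j" "j \<noteq> i \<Longrightarrow> hi K j \<le> hi L j"
proof -
  define p where "p = (\<chi> k. if k = i then c else lo K k)"
  define q where "q = (\<chi> k. if k = i then c else hi K k)"
  have "p \<in> K" "q \<in> K"
    using c mac_grid_cell(2)[OF K] unfolding mem_cell[OF K] by (auto simp: p_def q_def less_imp_le)
  then have "p \<in> L" "q \<in> L" using sub by (auto simp: p_def q_def)
  then have *: "lo L k \<le> p $ k" "q $ k \<le> hi L k" for k unfolding mem_cell[OF L] by auto
  show "lo L i \<le> c" "c \<le> hi L i" using *[of i] by (auto simp: p_def q_def)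
  show "j \<noteq> i \<Longrightarrow> lo L j \<le> lo K j" "j \<noteq> i \<Longrightarrow> hi K j \<le> hi L j"
    using *[of j] by (auto simp: p_def q_def)
qed

text \<open>In the directions other than \<open>i\<close>, \<open>L\<close> is at least as wide as
  \<open>K\<close>. If the ranges in direction \<open>i\<close> overlapped as well, the interiors
  would meet; so the cells lie on opposite sides of the level \<open>c\<close>.\<close>

lemma cells_sharing_side:
  assumes K: "mac_grid \<Omega> M" "K \<in> M" and L: "mac_grid \<Omega> M" "L \<in> M"
    and c: "lo K i \<le> c" "c \<le> hi K i" and sub: "{x\<in>K. x $ i = c} \<subseteq> L" and "K \<noteq> L"
  shows "hi K i = c \<and> lo L i = c \<or> lo K i = c \<and> hi L i = c"
proof -
  note bounds = cell_side_bounds[OF K L c sub]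
  have "hi K i \<le> lo L i \<or> hi L i \<le> lo K i"
  proof (rule ccontr)
    assume "\<not> ?thesis"
    \<comment> \<open>The midpoint of the overlap in direction \<open>i\<close>, and the centre of
      \<open>K\<close> in the others.\<close>
    moreover define z where "z = (\<chi> k. if k = i then (max (lo K i) (lo L i) + min (hi K i) (hi L i)) / 2
        else (lo K k + hi K k) / 2)"
    ultimately have "lo K k < z $ k \<and> z $ k < hi K k \<and> lo L k < z $ k \<and> z $ k < hi L k" for k
      using mac_grid_cell(2)[OF K, of k] mac_grid_cell(2)[OF L, of k] bounds(3)[of k] bounds(4)[of k]
      by (cases "k = i") (auto simp: max_def min_def)
    then have "z \<in> interior K \<inter> interior L"
      unfolding Int_iff mem_interior_cell[OF K] mem_interior_cell[OF L] by blast
    then show False using mac_grid_interior_disjoint[OF K L(2) \<open>K \<noteq> L\<close>] by blast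
  qed
  then show ?thesis using c bounds(1,2) by linarith
qed

text \<open>A common point shows that both cells see \<open>\<sigma>\<close> at the same level
  \<open>c\<close>. The conclusion excludes two cells on the same side of an edge.\<close>

lemma interface_of_cells:
  assumes grid: "mac_grid \<Omega> M" and KL: "K \<in> M" "L \<in> M" "K \<noteq> L"
    and \<sigma>: "\<sigma> \<in> edges i K" "\<sigma> \<in> edges i L"
  shows "\<sigma> = upper_edge i K \<and> \<sigma> = lower_edge i L \<or> \<sigma> = upper_edge i L \<and> \<sigma> = lower_edge i K"
proof -
  obtain c where c: "\<sigma> = {x\<in>K. x $ i = c}" "lo K i \<le> c" "c \<le> hi K i"
    using edge_of_cell[OF grid KL(1) \<sigma>(1)] by metis
  obtain c' where c': "\<sigma> = {x\<in>L. x $ i = c'}"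
    using edge_of_cell[OF grid KL(2) \<sigma>(2)] by metis
  obtain x where "x \<in> \<sigma>"
    using \<sigma>(1) lower_edge_nonempty[OF grid KL(1)] upper_edge_nonempty[OF grid KL(1)]
    by (auto simp: edges_def)
  then have "x \<in> {x\<in>K. x $ i = c}" "x \<in> {x\<in>L. x $ i = c'}"
    using c(1) c' by blast+
  then have "c' = c" by simp
  then have c': "\<sigma> = {x\<in>L. x $ i = c}" using c' by simp
  have "hi K i = c \<and> lo L i = c \<or> lo K i = c \<and> hi L i = c"
  proof (rule cells_sharing_side[OF grid KL(1) grid KL(2) c(2,3) _ KL(3)])
    show "{x\<in>K. x $ i = c} \<subseteq> L" unfolding c(1)[symmetric] c' by blast
  qed
  then show ?thesis
  proof (elim disjE conjE)
    assume "hi K i = c" "lo L i = c"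
    have "\<sigma> = upper_edge i K" unfolding upper_edge_def \<open>hi K i = c\<close> by (rule c(1))
    moreover have "\<sigma> = lower_edge i L" unfolding lower_edge_def \<open>lo L i = c\<close> by (rule c')
    ultimately show ?thesis by (intro disjI1 conjI)
  next
    assume "lo K i = c" "hi L i = c"
    have "\<sigma> = lower_edge i K" unfolding lower_edge_def \<open>lo K i = c\<close> by (rule c(1))
    moreover have "\<sigma> = upper_edge i L" unfolding upper_edge_def \<open>hi L i = c\<close> by (rule c')
    ultimately show ?thesis by (intro disjI2 conjI)
  qed
qed

lemma lower_edge_neq_upper_edge:
  assumes "mac_grid \<Omega> M" "K \<in> M"
  shows "lower_edge i K \<noteq> upper_edge i K"
proof -
  have "interval_upperbound K \<in> upper_edge i K"
    using mac_grid_cell(2)[OF assms]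
    by (auto simp: upper_edge_def mem_cell[OF assms] less_imp_le)
  moreover have "interval_upperbound K \<notin> lower_edge i K"
    using mac_grid_cell(2)[OF assms, of i] by (auto simp: lower_edge_def)
  ultimately show ?thesis by blast
qed

text \<open>An edge not contained in the frontier has a point in \<open>\<Omega>\<close>, where a
  second cell must touch \<open>K\<close>. That the cells meet in a common face extends this contact
  from one point to the whole edge.\<close>

lemma internal_edge_other_cell:
  assumes grid: "mac_grid \<Omega> M" and "open \<Omega>" and \<sigma>: "\<sigma> \<in> int_edges \<Omega> M i"
    and K: "K \<in> M" "\<sigma> \<in> edges i K"
  obtains L where "L \<in> M" "L \<noteq> K" "\<sigma> \<in> edges i L"
proof -
  note gK = grid K(1)
  have cover: "closure \<Omega> = \<Union>M"
    using grid division_ofD(6) by (auto simp: mac_grid_def)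
  obtain c where c: "c \<in> {lo K i, hi K i}" and \<sigma>_eq: "\<sigma> = {x\<in>K. x $ i = c}"
    and cb: "lo K i \<le> c" "c \<le> hi K i"
    using edge_of_cell[OF gK K(2)] by blast
  obtain x where x: "x \<in> K" "x $ i = c" "x \<notin> frontier \<Omega>"
    using \<sigma> by (auto simp: int_edges_def ext_edges_def \<sigma>_eq)
  have "x \<in> \<Omega>"
    using x cover K(1) interior_open[OF \<open>open \<Omega>\<close>] by (auto simp: frontier_def)
  \<comment> \<open>The point slides within the side towards its centre: any \<open>t > 0\<close>
    makes the inequalities in the other directions strict, and a small \<open>t\<close> stays in the
    open set \<open>\<Omega>\<close>.\<close>
  define g where "g = (\<lambda>t::real. x + t *\<^sub>R ((\<chi> k. if k = i then c else (lo K k + hi K k) / 2) - x))"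
  have "(g \<longlongrightarrow> x) (at_right 0)" unfolding g_def by (auto intro!: tendsto_eq_intros)
  then have "\<forall>\<^sub>F t in at_right 0. g t \<in> \<Omega>"
    using topological_tendstoD \<open>open \<Omega>\<close> \<open>x \<in> \<Omega>\<close> by blast
  then have "\<forall>\<^sub>F t in at_right 0. 0 < t \<and> t < 1 \<and> g t \<in> \<Omega>"
    using eventually_conj[OF eventually_at_right_real[of 0 "1::real"]] by auto
  from eventually_happens'[OF trivial_limit_at_right_real this]
  obtain t where t: "0 < t" "t < 1" "g t \<in> \<Omega>" by blast
  define y where "y = g t"
  have yi: "y $ i = c" using x by (simp add: y_def g_def)
  have y\<Omega>: "y \<in> \<Omega>" using t by (simp add: y_def)
  have ystrict: "lo K j < y $ j" "y $ j < hi K j" if "j \<noteq> i" for j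
  proof -
    have eq: "y $ j = (1 - t) * x $ j + t * ((lo K j + hi K j) / 2)"
      using that by (simp add: y_def g_def algebra_simps)
    have xj: "lo K j \<le> x $ j" "x $ j \<le> hi K j" using x(1) unfolding mem_cell[OF gK] by auto
    have "lo K j < (lo K j + hi K j) / 2" "(lo K j + hi K j) / 2 < hi K j"
      using mac_grid_cell(2)[OF gK, of j] by auto
    then have m: "t * lo K j < t * ((lo K j + hi K j) / 2)" "t * ((lo K j + hi K j) / 2) < t * hi K j"
      using t(1) by (auto intro!: mult_strict_left_mono simp del: times_divide_eq_right)
    have x: "(1 - t) * lo K j \<le> (1 - t) * x $ j" "(1 - t) * x $ j \<le> (1 - t) * hi K j"
      using t xj by (auto intro!: mult_left_mono)
    have "(1 - t) * lo K j + t * lo K j < y $ j" "y $ j < (1 - t) * hi K j + t * hi K j"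
      unfolding eq using x m by (auto intro!: add_le_less_mono simp del: times_divide_eq_right)
    then show "lo K j < y $ j" "y $ j < hi K j" by (simp_all add: algebra_simps)
  qed
  have yK: "y \<in> K"
    unfolding mem_cell[OF gK]
  proof
    fix j show "lo K j \<le> y $ j \<and> y $ j \<le> hi K j"
      using cb yi ystrict[of j] by (cases "j = i") auto
  qed
  obtain L where L: "L \<in> M" "L \<noteq> K" "y \<in> L"
  proof -
    \<comment> \<open>If no other cell contained \<open>y\<close>, a neighbourhood of
      \<open>y\<close> would lie in \<open>K\<close>, although coordinate \<open>i\<close> of
      \<open>y\<close> is extremal in \<open>K\<close>.\<close>
    have "y \<in> \<Union>(M - {K})"
    proof (rule ccontr)
      assume "y \<notin> \<Union>(M - {K})"
      moreover have "closed (\<Union>(M - {K}))"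
      proof (rule closed_Union)
        show "finite (M - {K})" using mac_grid_finite[OF grid] by simp
        show "\<forall>L\<in>M - {K}. closed L"
          using mac_grid_closed[OF grid] by blast
      qed
      ultimately have "open (\<Omega> - \<Union>(M - {K}))" "y \<in> \<Omega> - \<Union>(M - {K})"
        using \<open>open \<Omega>\<close> y\<Omega> by auto
      moreover have "\<Omega> - \<Union>(M - {K}) \<subseteq> K" using cover closure_subset[of \<Omega>] by blast
      ultimately have "y \<in> interior K" by (meson interiorI)
      then have "lo K i < y $ i" "y $ i < hi K i" unfolding mem_interior_cell[OF gK] by auto
      then show False using yi c by auto
    qed
    then show ?thesis using that by blast
  qed
  have faces: "K \<inter> L face_of K" "K \<inter> L face_of L"
    using grid K(1) L(1) unfolding mac_grid_def by blast+
  have sub: "{x\<in>K. x $ i = c} \<subseteq> K \<inter> L"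
    by (rule cell_side_subset_face[OF gK faces(1)]) (use yK L yi ystrict in auto)
  then have sub': "{x\<in>K. x $ i = c} \<subseteq> L" by blast
  note bounds = cell_side_bounds[OF gK grid L(1) cb sub']
  have "lo L j < y $ j \<and> y $ j < hi L j" if "j \<noteq> i" for j
    using bounds(3,4)[OF that] ystrict[OF that] by auto
  \<comment> \<open>The face argument is repeated from \<open>L\<close>; otherwise
    \<open>\<sigma>\<close> might be just a piece of a longer side of \<open>L\<close>.\<close>
  then have "{x\<in>L. x $ i = c} \<subseteq> K \<inter> L"
    by (intro cell_side_subset_face[OF grid L(1) faces(2), of y]) (use yK L yi in auto)
  then have "\<sigma> = {x\<in>L. x $ i = c}" using sub' \<sigma>_eq by blast
  moreover have "c \<in> {lo L i, hi L i}"
    using cells_sharing_side[OF gK grid L(1) cb sub'] L(2) by auto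
  ultimately have "\<sigma> \<in> edges i L" unfolding edges_eq by blast
  then show ?thesis using that L by blast
qed

text \<open>A third cell would have to lie opposite to \<open>K\<close> and opposite to
  \<open>L\<close>, so \<open>\<sigma>\<close> would be both its lower and its upper edge. With
  exactly two cells, the descriptions in \<open>lower_cell\<close> and \<open>neighbour\<close> can
  be evaluated.\<close>

lemma internal_edge_cells:
  assumes grid: "mac_grid \<Omega> M" and "open \<Omega>" and \<sigma>: "\<sigma> \<in> int_edges \<Omega> M i"
  obtains K L where "K \<in> M" "L \<in> M" "K \<noteq> L" "\<sigma> = upper_edge i K" "\<sigma> = lower_edge i L"
    "adjacent_cells M i \<sigma> = {K, L}" "lower_cell M i \<sigma> = K"
    "neighbour M i \<sigma> K = L" "neighbour M i \<sigma> L = K"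
proof -
  obtain J where J: "J \<in> M" "\<sigma> \<in> edges i J"
    using \<sigma> by (auto simp: int_edges_def mesh_edges_def)
  obtain J' where J': "J' \<in> M" "J' \<noteq> J" "\<sigma> \<in> edges i J'"
    using internal_edge_other_cell[OF grid \<open>open \<Omega>\<close> \<sigma> J] .
  have "\<exists>K L. K \<in> M \<and> L \<in> M \<and> K \<noteq> L \<and> \<sigma> = upper_edge i K \<and> \<sigma> = lower_edge i L"
    using interface_of_cells[OF grid J(1) J'(1) J'(2)[symmetric] J(2) J'(3)] J(1) J'(1,2) by blast
  then obtain K L where KL: "K \<in> M" "L \<in> M" "K \<noteq> L" "\<sigma> = upper_edge i K" "\<sigma> = lower_edge i L"
    by blast
  have edges: "\<sigma> \<in> edges i K" "\<sigma> \<in> edges i L" using KL by (simp_all add: edges_def)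
  have no: "\<sigma> \<noteq> lower_edge i K" "\<sigma> \<noteq> upper_edge i L"
    using KL(4,5) lower_edge_neq_upper_edge[OF grid KL(1), of i] lower_edge_neq_upper_edge[OF grid KL(2), of i]
    by simp_all
  have only: "I = K \<or> I = L" if I: "I \<in> M" "\<sigma> \<in> edges i I" for I
  proof (rule ccontr)
    assume "\<not> ?thesis"
    then have ne: "I \<noteq> K" "I \<noteq> L" by auto
    have "\<sigma> = lower_edge i I" using interface_of_cells[OF grid I(1) KL(1) ne(1) I(2) edges(1)] no by blast
    moreover have "\<sigma> = upper_edge i I" using interface_of_cells[OF grid I(1) KL(2) ne(2) I(2) edges(2)] no by blast
    ultimately show False using lower_edge_neq_upper_edge[OF grid I(1), of i] by simp
  qed
  have "adjacent_cells M i \<sigma> = {K, L}" using only KL edges by (auto simp: adjacent_cells_def)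
  moreover have "lower_cell M i \<sigma> = K"
    unfolding lower_cell_def
  proof (rule the_equality)
    show "I = K" if "I \<in> M \<and> \<sigma> = upper_edge i I" for I
      using that only[of I] no by (auto simp: edges_def)
  qed (use KL in blast)
  moreover have "neighbour M i \<sigma> K = L"
    unfolding neighbour_def
  proof (rule the_equality)
    show "J = L" if "J \<in> M \<and> J \<noteq> K \<and> \<sigma> \<in> edges i J" for J using that only[of J] by blast
  qed (use KL edges in simp)
  moreover have "neighbour M i \<sigma> L = K"
    unfolding neighbour_def
  proof (rule the_equality)
    show "J = K" if "J \<in> M \<and> J \<noteq> L \<and> \<sigma> \<in> edges i J" for J using that only[of J] by blast
  qed (use KL edges in simp)
  ultimately show ?thesis by (rule that[OF KL])
qed


section \<open>Dual cells\<close>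

lemma val_eqI:
  assumes "interior A \<noteq> {}" "\<And>x. x \<in> interior A \<Longrightarrow> f x = c"
  shows "val f A = c"
  unfolding val_def using assms by (intro the_equality) auto

lemma const_on_imp_eq_val: "const_on A f \<Longrightarrow> x \<in> interior A \<Longrightarrow> f x = val f A"
  unfolding const_on_def by (metis empty_iff val_eqI)

text \<open>A point lies in the interior of at most one \<open>A k\<close>, which determines the
  value there; any other point gets an arbitrary value. This produces the density on cells and the
  velocity on dual cells.\<close>

lemma piecewise_constant_exists:
  fixes A :: "'b \<Rightarrow> (real^'d::finite) set"
  assumes nonempty: "\<And>k. k \<in> I \<Longrightarrow> interior (A k) \<noteq> {}"
    and disjoint: "\<And>j k. \<lbrakk>j \<in> I; k \<in> I; j \<noteq> k\<rbrakk> \<Longrightarrow> interior (A j) \<inter> interior (A k) = {}"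
  shows "\<exists>f. \<forall>k\<in>I. const_on (A k) f \<and> val f (A k) = v k"
proof -
  define f where "f = (\<lambda>x. v (THE k. k \<in> I \<and> x \<in> interior (A k)))"
  have f: "f x = v k" if k: "k \<in> I" and x: "x \<in> interior (A k)" for x k
  proof -
    have "(THE k. k \<in> I \<and> x \<in> interior (A k)) = k"
    proof (rule the_equality)
      show "j = k" if "j \<in> I \<and> x \<in> interior (A j)" for j
        using disjoint[of j k] that k x by blast
    qed (use k x in simp)
    then show ?thesis by (simp add: f_def)
  qed
  have "const_on (A k) f \<and> val f (A k) = v k" if k: "k \<in> I" for k
    using f[OF k] val_eqI[OF nonempty[OF k]] unfolding const_on_def by blast
  then show ?thesis by blast
qed

text \<open>Closedness matters: rationals and irrationals both have empty interior, but together
  they fill the real line.\<close>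

lemma interior_finite_Union_closed_empty:
  assumes "finite F" "\<And>S. S \<in> F \<Longrightarrow> closed S \<and> interior S = {}"
  shows "interior (\<Union>F) = {}"
  using assms
proof (induction F rule: finite_induct)
  case (insert S F)
  then have "interior (S \<union> \<Union>F) = interior S"
    by (intro interior_closed_Un_empty_interior) auto
  then show ?case using insert by simp
qed simp

section \<open>Halves of cells and their overlaps\<close>

lemma half_cell_box:
  assumes "mac_grid \<Omega> M" "K \<in> M"
  obtains p q where "half_cell i \<sigma> K = cbox p q" "\<And>j. p $ j < q $ j"
proof
  let ?m = "(lo K i + hi K i) / 2"
  define p where "p = (\<chi> j. if j = i \<and> \<sigma> = upper_edge i K then ?m else lo K j)"
  define q where "q = (\<chi> j. if j = i \<and> \<sigma> \<noteq> upper_edge i K then ?m else hi K j)"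
  note lohi = mac_grid_cell(2)[OF assms]
  have mid: "lo K i < ?m" "?m < hi K i" using lohi[of i] by auto
  show "p $ j < q $ j" for j using lohi[of j] by (auto simp: p_def q_def)
  show "half_cell i \<sigma> K = cbox p q"
  proof (rule set_eqI)
    fix x
    have "x \<in> half_cell i \<sigma> K \<longleftrightarrow> (\<forall>j. lo K j \<le> x $ j \<and> x $ j \<le> hi K j) \<and>
        (if \<sigma> = upper_edge i K then ?m \<le> x $ i else x $ i \<le> ?m)"
      by (simp add: half_cell_def mem_cell[OF assms])
    also have "\<dots> \<longleftrightarrow> (\<forall>j. p $ j \<le> x $ j \<and> x $ j \<le> q $ j)"
    proof (cases "\<sigma> = upper_edge i K")
      case True
      have "lo K i \<le> x $ i" if "?m \<le> x $ i" by (rule order_trans[OF less_imp_le[OF mid(1)] that])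
      then show ?thesis using True by (auto simp: p_def q_def)
    next
      case False
      have "x $ i \<le> hi K i" if "x $ i \<le> ?m" by (rule order_trans[OF that less_imp_le[OF mid(2)]])
      then show ?thesis using False by (auto simp: p_def q_def)
    qed
    also have "\<dots> \<longleftrightarrow> x \<in> cbox p q" by (simp add: mem_box_cart)
    finally show "x \<in> half_cell i \<sigma> K \<longleftrightarrow> x \<in> cbox p q" .
  qed
qed

lemma half_cell_subset: "half_cell i \<sigma> K \<subseteq> K"
  by (auto simp: half_cell_def)

lemma
  assumes "mac_grid \<Omega> M" "K \<in> M"
  shows half_cell_closed: "closed (half_cell i \<sigma> K)"
  and half_cell_interior: "interior (half_cell i \<sigma> K) \<noteq> {}"
  and half_cell_fmeasurable: "half_cell i \<sigma> K \<in> fmeasurable lborel"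
  and half_cell_measure: "0 < measure lborel (half_cell i \<sigma> K)"
proof -
  obtain p q where h: "half_cell i \<sigma> K = cbox p q" and pq: "\<And>j. p $ j < q $ j"
    using half_cell_box[OF assms] by blast
  show "closed (half_cell i \<sigma> K)" "half_cell i \<sigma> K \<in> fmeasurable lborel"
    by (simp_all add: h closed_cbox)
  show "interior (half_cell i \<sigma> K) \<noteq> {}"
    using pq by (simp add: h interior_cbox interval_ne_empty_cart)
  show "0 < measure lborel (half_cell i \<sigma> K)"
    unfolding h using pq by (intro content_pos_lt) (auto simp: Basis_vec_def inner_axis)
qed

text \<open>Two halves of the same cell belong to opposite edges and meet in the hyperplane halfway
  between them; halves of different cells inherit disjoint interiors from the cells.\<close>

lemma half_cells_overlap:
  assumes grid: "mac_grid \<Omega> M" and KL: "K \<in> M" "L \<in> M"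
    and edges: "\<sigma> \<in> edges i K" "\<tau> \<in> edges i L" and "\<sigma> \<noteq> \<tau>"
  shows "interior (half_cell i \<sigma> K \<inter> half_cell i \<tau> L) = {}"
proof (cases "K = L")
  case True
  have "half_cell i \<sigma> K \<inter> half_cell i \<tau> L \<subseteq> {x. axis i 1 \<bullet> x = (lo K i + hi K i) / 2}"
    using edges \<open>\<sigma> \<noteq> \<tau>\<close> lower_edge_neq_upper_edge[OF grid KL(1), of i] True
    by (auto simp: edges_def half_cell_def inner_axis')
  moreover have "interior {x::real^'a. axis i 1 \<bullet> x = (lo K i + hi K i) / 2} = {}"
    by (rule interior_hyperplane) (simp add: axis_eq_0_iff)
  ultimately show ?thesis using interior_mono by blast
next
  case False
  have "interior (half_cell i \<sigma> K \<inter> half_cell i \<tau> L) \<subseteq> interior K \<inter> interior L"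
    using interior_mono[OF half_cell_subset] by auto
  then show ?thesis using mac_grid_interior_disjoint[OF grid KL False] by blast
qed

lemma finite_adjacent_cells: "mac_grid \<Omega> M \<Longrightarrow> finite (adjacent_cells M i \<sigma>)"
  using mac_grid_finite[of \<Omega> M] by (simp add: adjacent_cells_def)

lemma mesh_edge_adjacent_cell:
  assumes "\<sigma> \<in> mesh_edges M i"
  obtains K where "K \<in> adjacent_cells M i \<sigma>" "K \<in> M"
  using assms by (auto simp: mesh_edges_def adjacent_cells_def)

lemma dual_cell_interior:
  assumes "mac_grid \<Omega> M" "\<sigma> \<in> mesh_edges M i"
  shows "interior (dual_cell M i \<sigma>) \<noteq> {}"
proof -
  obtain K where K: "K \<in> adjacent_cells M i \<sigma>" "K \<in> M" using mesh_edge_adjacent_cell[OF assms(2)] .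
  then have "interior (half_cell i \<sigma> K) \<subseteq> interior (dual_cell M i \<sigma>)"
    by (intro interior_mono) (auto simp: dual_cell_def)
  then show ?thesis using half_cell_interior[OF assms(1) K(2)] by blast
qed

lemma dual_cell_measure:
  assumes "mac_grid \<Omega> M" "\<sigma> \<in> mesh_edges M i"
  shows "0 < measure lborel (dual_cell M i \<sigma>)"
proof -
  obtain K where K: "K \<in> adjacent_cells M i \<sigma>" "K \<in> M" using mesh_edge_adjacent_cell[OF assms(2)] .
  have "dual_cell M i \<sigma> \<in> fmeasurable lborel"
    unfolding dual_cell_def using finite_adjacent_cells[OF assms(1)] half_cell_fmeasurable[OF assms(1)]
    by (intro fmeasurable.finite_UN) (auto simp: adjacent_cells_def)
  then have "measure lborel (half_cell i \<sigma> K) \<le> measure lborel (dual_cell M i \<sigma>)"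
    using K half_cell_fmeasurable[OF assms(1) K(2), of i \<sigma>]
    by (intro measure_mono_fmeasurable) (auto simp: dual_cell_def)
  then show ?thesis using half_cell_measure[OF assms(1) K(2), of i \<sigma>] by linarith
qed

text \<open>The interior of a dual cell may contain points of \<open>\<sigma>\<close> that are
  interior to neither half, so comparing interiors of halves is not enough. Instead the whole
  intersection is covered by finitely many closed overlaps with empty interior.\<close>

lemma dual_cells_disjoint:
  assumes grid: "mac_grid \<Omega> M" and "\<sigma> \<noteq> \<tau>"
  shows "interior (dual_cell M i \<sigma>) \<inter> interior (dual_cell M i \<tau>) = {}"
proof -
  define F where "F = (\<lambda>(K, L). half_cell i \<sigma> K \<inter> half_cell i \<tau> L) `
      (adjacent_cells M i \<sigma> \<times> adjacent_cells M i \<tau>)"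
  have "interior (\<Union>F) = {}"
  proof (rule interior_finite_Union_closed_empty)
    show "finite F" unfolding F_def using finite_adjacent_cells[OF grid] by simp
    fix S assume "S \<in> F"
    then obtain K L where KL: "K \<in> adjacent_cells M i \<sigma>" "L \<in> adjacent_cells M i \<tau>"
      and S: "S = half_cell i \<sigma> K \<inter> half_cell i \<tau> L"
      by (auto simp: F_def)
    show "closed S \<and> interior S = {}"
      unfolding S using KL half_cell_closed[OF grid] half_cells_overlap[OF grid _ _ _ _ \<open>\<sigma> \<noteq> \<tau>\<close>]
      by (auto simp: adjacent_cells_def simp del: interior_Int)
  qed
  moreover have "dual_cell M i \<sigma> \<inter> dual_cell M i \<tau> \<subseteq> \<Union>F"
    unfolding dual_cell_def F_def by fastforce
  ultimately show ?thesis using interior_mono by (metis interior_Int subset_empty)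
qed

text \<open>This average is the divisor when the momentum balance is solved for the new
  velocity.\<close>

lemma dual_avg_pos:
  assumes grid: "mac_grid \<Omega> M" and \<sigma>: "\<sigma> \<in> mesh_edges M i" and q: "\<And>K. K \<in> M \<Longrightarrow> 0 < q K"
  shows "0 < dual_avg M q i \<sigma>"
proof -
  have "adjacent_cells M i \<sigma> \<noteq> {}" using mesh_edge_adjacent_cell[OF \<sigma>] by blast
  then have "0 < (\<Sum>K\<in>adjacent_cells M i \<sigma>. measure lborel (half_cell i \<sigma> K) * q K)"
    using finite_adjacent_cells[OF grid] half_cell_measure[OF grid] q
    by (intro sum_pos) (auto simp: adjacent_cells_def)
  then show ?thesis using dual_cell_measure[OF grid \<sigma>] by (simp add: dual_avg_def)
qed


section \<open>The semi-implicit scheme\<close>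

lemma finite_edges: "finite (edges i K)"
  by (simp add: edges_def)

lemma axis_inner_outward_normal:
  "axis i 1 \<bullet> outward_normal i \<sigma> K = (if \<sigma> = upper_edge i K then 1 else - 1)"
  by (simp add: outward_normal_def inner_axis_axis)

text \<open>\<open>edge_measure\<close> reads the bounds of the set \<open>\<sigma>\<close>, so
  \<open>\<sigma>\<close> is first identified with a box that is degenerate in direction
  \<open>i\<close>.\<close>

lemma edge_measure_nonneg:
  assumes grid: "mac_grid \<Omega> M" "K \<in> M" and \<sigma>: "\<sigma> \<in> edges i K"
  shows "0 \<le> edge_measure i \<sigma>"
proof -
  obtain c where c: "\<sigma> = {x\<in>K. x $ i = c}" "lo K i \<le> c" "c \<le> hi K i"
    using edge_of_cell[OF grid \<sigma>] by blast
  define p where "p = (\<chi> j. if j = i then c else lo K j)"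
  define q where "q = (\<chi> j. if j = i then c else hi K j)"
  have pq: "p $ j \<le> q $ j" for j
    using mac_grid_cell(2)[OF grid, of j] by (simp add: p_def q_def)
  have "x \<in> \<sigma> \<longleftrightarrow> (\<forall>j. p $ j \<le> x $ j \<and> x $ j \<le> q $ j)" for x
  proof -
    have "x \<in> \<sigma> \<longleftrightarrow> (\<forall>j. lo K j \<le> x $ j \<and> x $ j \<le> hi K j) \<and> x $ i = c"
      by (simp add: c(1) mem_cell[OF grid])
    also have "\<dots> \<longleftrightarrow> (\<forall>j. p $ j \<le> x $ j \<and> x $ j \<le> q $ j)"
    proof
      assume *: "(\<forall>j. lo K j \<le> x $ j \<and> x $ j \<le> hi K j) \<and> x $ i = c"
      show "\<forall>j. p $ j \<le> x $ j \<and> x $ j \<le> q $ j"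
        using * by (simp add: p_def q_def)
    next
      assume *: "\<forall>j. p $ j \<le> x $ j \<and> x $ j \<le> q $ j"
      have "lo K j \<le> x $ j \<and> x $ j \<le> hi K j" for j
        using spec[OF *, of j] c(2,3) by (cases "j = i") (auto simp: p_def q_def)
      moreover have "x $ i = c" using spec[OF *, of i] by (simp add: p_def q_def)
      ultimately show "(\<forall>j. lo K j \<le> x $ j \<and> x $ j \<le> hi K j) \<and> x $ i = c" by blast
    qed
    finally show ?thesis .
  qed
  then have \<sigma>_eq: "\<sigma> = cbox p q" by (auto simp: mem_box_cart)
  have "cbox p q \<noteq> {}" using pq by (simp add: interval_ne_empty_cart)
  then have "interval_lowerbound \<sigma> = p" "interval_upperbound \<sigma> = q"
    unfolding \<sigma>_eq by (rule interval_bounds')+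
  then show ?thesis unfolding edge_measure_def using pq by (auto intro!: prod_nonneg)
qed

text \<open>\<open>discrete_deriv\<close> is written from the lower cell. Seen from the upper cell,
  the pressure difference and the normal both change sign, so either cell finds the same formula in
  terms of itself and its neighbour.\<close>

lemma mass_flux_eq_upwind_flux:
  assumes grid: "mac_grid \<Omega> M" and "open \<Omega>" and \<sigma>: "\<sigma> \<in> int_edges \<Omega> M i"
    and K: "K \<in> M" "\<sigma> \<in> edges i K"
  shows "mass_flux \<Omega> M s \<gamma> r w i \<sigma> K =
    upwind_flux (edge_measure i \<sigma>) (s * (edge_measure i \<sigma> / measure lborel (dual_cell M i \<sigma>))) \<gamma>
      (outward_comp w i \<sigma> K) (r K) (r (neighbour M i \<sigma> K))"
proof -
  obtain A B where AB: "A \<in> M" "B \<in> M" "A \<noteq> B" "\<sigma> = upper_edge i A" "\<sigma> = lower_edge i B"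
    "adjacent_cells M i \<sigma> = {A, B}" "lower_cell M i \<sigma> = A"
    "neighbour M i \<sigma> A = B" "neighbour M i \<sigma> B = A"
    using internal_edge_cells[OF grid \<open>open \<Omega>\<close> \<sigma>] .
  have "\<sigma> \<noteq> upper_edge i B" using lower_edge_neq_upper_edge[OF grid AB(2), of i] AB(5) by simp
  then have normal: "axis i 1 \<bullet> outward_normal i \<sigma> A = 1" "axis i 1 \<bullet> outward_normal i \<sigma> B = - 1"
    using AB(4) by (auto simp: axis_inner_outward_normal)
  define k where "k = s * (edge_measure i \<sigma> / measure lborel (dual_cell M i \<sigma>))"
  have du: "delta_u \<Omega> M s \<gamma> r i \<sigma> = k * (r B powr \<gamma> - r A powr \<gamma>)"
    using \<sigma> by (simp add: delta_u_def discrete_deriv_def AB(7,8) normal Let_def k_def pressure_def)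
  have "K \<in> {A, B}" using K AB(6) unfolding adjacent_cells_def by blast
  then have "outward_comp (delta_u \<Omega> M s \<gamma> r) i \<sigma> K
      = k * (r (neighbour M i \<sigma> K) powr \<gamma> - r K powr \<gamma>)"
    unfolding outward_comp_def du using normal AB(8,9) by (auto simp: algebra_simps)
  then show ?thesis
    using \<sigma> unfolding mass_flux_def v_plus_def v_minus_def upwind_flux_def k_def[symmetric] by simp
qed

text \<open>Regrouped by edges, the sum pairs the two opposite fluxes of each internal edge, while
  external edges contribute \<open>0\<close>.\<close>

lemma mass_flux_conservative:
  assumes grid: "mac_grid \<Omega> M" and "open \<Omega>"
  shows "(\<Sum>K\<in>M. \<Sum>i\<in>UNIV. \<Sum>\<sigma>\<in>edges i K. mass_flux \<Omega> M s \<gamma> r w i \<sigma> K) = 0"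
proof -
  have fin: "finite M" "finite (mesh_edges M i)" for i
    using mac_grid_finite[OF grid] by (auto simp: mesh_edges_def finite_edges)
  have zero: "(\<Sum>K\<in>adjacent_cells M i \<sigma>. mass_flux \<Omega> M s \<gamma> r w i \<sigma> K) = 0" for i \<sigma>
  proof (cases "\<sigma> \<in> int_edges \<Omega> M i")
    case True
    obtain A B where AB: "A \<in> M" "B \<in> M" "A \<noteq> B" "\<sigma> = upper_edge i A" "\<sigma> = lower_edge i B"
      "adjacent_cells M i \<sigma> = {A, B}" "lower_cell M i \<sigma> = A"
      "neighbour M i \<sigma> A = B" "neighbour M i \<sigma> B = A"
      using internal_edge_cells[OF grid \<open>open \<Omega>\<close> True] .
    have "\<sigma> \<noteq> upper_edge i B" using lower_edge_neq_upper_edge[OF grid AB(2), of i] AB(5) by simp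
    then have "outward_comp w i \<sigma> B = - outward_comp w i \<sigma> A"
      using AB(4) by (simp add: outward_comp_def axis_inner_outward_normal)
    moreover have "\<sigma> \<in> edges i A" "\<sigma> \<in> edges i B" using AB(4,5) by (simp_all add: edges_def)
    ultimately have "mass_flux \<Omega> M s \<gamma> r w i \<sigma> B = - mass_flux \<Omega> M s \<gamma> r w i \<sigma> A"
      using mass_flux_eq_upwind_flux[OF assms True AB(1)] mass_flux_eq_upwind_flux[OF assms True AB(2)]
        AB(8,9) by (simp add: upwind_flux_antisym)
    then show ?thesis using AB(3,6) by simp
  qed (simp add: mass_flux_def)
  have "(\<Sum>K\<in>M. \<Sum>\<sigma>\<in>edges i K. mass_flux \<Omega> M s \<gamma> r w i \<sigma> K) = 0" for i
  proof -
    have "(\<Sum>K\<in>M. \<Sum>\<sigma>\<in>edges i K. mass_flux \<Omega> M s \<gamma> r w i \<sigma> K)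
        = (\<Sum>K\<in>M. \<Sum>\<sigma>\<in>{\<sigma>. \<sigma> \<in> mesh_edges M i \<and> \<sigma> \<in> edges i K}. mass_flux \<Omega> M s \<gamma> r w i \<sigma> K)"
      by (intro sum.cong refl) (auto simp: mesh_edges_def)
    also have "\<dots> = (\<Sum>\<sigma>\<in>mesh_edges M i. \<Sum>K\<in>adjacent_cells M i \<sigma>. mass_flux \<Omega> M s \<gamma> r w i \<sigma> K)"
      unfolding adjacent_cells_def by (rule sum.swap_restrict[OF fin])
    also have "\<dots> = 0" by (simp add: zero)
    finally show ?thesis .
  qed
  then show ?thesis by (subst sum.swap) simp
qed

lemma mass_balance_solvable:
  fixes w :: "'d::finite \<Rightarrow> (real^'d) set \<Rightarrow> real"
  assumes grid: "mac_grid \<Omega> M" and "open \<Omega>"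
    and pos: "1 \<le> \<gamma>" "0 \<le> s" "0 < dt" and b: "\<And>K. K \<in> M \<Longrightarrow> 0 < b K"
  shows "\<exists>r. \<forall>K\<in>M. 0 < r K \<and> 1 / dt * (r K - b K)
    + 1 / measure lborel K * (\<Sum>i\<in>UNIV. \<Sum>\<sigma>\<in>edges i K. mass_flux \<Omega> M s \<gamma> r w i \<sigma> K) = 0"
proof -
  \<comment> \<open>Multiplying the balance of \<open>K\<close> by its measure removes the factor in
    front of the fluxes; in this form they cancel in the sum over the cells.\<close>
  define c where "c = (\<lambda>K::(real^'d) set. measure lborel K / dt)"
  define F where "F = (\<lambda>r i \<sigma> K. mass_flux \<Omega> M s \<gamma> r w i \<sigma> K)"
  define k where "k = (\<lambda>i \<sigma>. s * (edge_measure i \<sigma> / measure lborel (dual_cell M i \<sigma>)))"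
  have k0: "0 \<le> k i \<sigma>" if "K \<in> M" "\<sigma> \<in> edges i K" for i \<sigma> K
    unfolding k_def using pos edge_measure_nonneg[OF grid that] by simp
  have F_cases: "(\<sigma> \<in> int_edges \<Omega> M i \<and> (\<forall>r. F r i \<sigma> K = upwind_flux (edge_measure i \<sigma>) (k i \<sigma>) \<gamma>
      (outward_comp w i \<sigma> K) (r K) (r (neighbour M i \<sigma> K)))) \<or> (\<forall>r. F r i \<sigma> K = 0)"
    if "K \<in> M" "\<sigma> \<in> edges i K" for i \<sigma> K
    unfolding F_def k_def using mass_flux_eq_upwind_flux[OF grid \<open>open \<Omega>\<close> _ that]
    by (cases "\<sigma> \<in> int_edges \<Omega> M i") (auto simp: mass_flux_def)
  have meas: "0 < measure lborel K" if "K \<in> M" for K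
  proof -
    have "0 < measure lborel (cbox (interval_lowerbound K) (interval_upperbound K))"
      using mac_grid_cell(2)[OF grid that] by (intro content_pos_lt) (auto simp: Basis_vec_def inner_axis)
    then show ?thesis using arg_cong[OF mac_grid_cell(1)[OF grid that], of "measure lborel"] by linarith
  qed
  have "\<exists>r. \<forall>K\<in>M. 0 < r K \<and> c K * (r K - b K) + (\<Sum>i\<in>UNIV. \<Sum>\<sigma>\<in>edges i K. F r i \<sigma> K) = 0"
  proof (rule conservative_scheme_has_positive_solution)
    show "finite M" using mac_grid_finite[OF grid] .
    show "0 < c K" if "K \<in> M" for K using meas[OF that] pos by (simp add: c_def)
    show "0 < b K" if "K \<in> M" for K using b[OF that] .
    show "(\<Sum>K\<in>M. \<Sum>i\<in>UNIV. \<Sum>\<sigma>\<in>edges i K. F r i \<sigma> K) = 0" for r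
      unfolding F_def by (rule mass_flux_conservative[OF grid \<open>open \<Omega>\<close>])
    show "\<exists>\<Lambda>. \<forall>K\<in>M. \<forall>r r'. (\<forall>L. 0 \<le> r L \<and> r L \<le> r' L \<and> r' L \<le> R) \<longrightarrow>
      (\<Sum>i\<in>UNIV. \<Sum>\<sigma>\<in>edges i K. F r' i \<sigma> K) - (\<Sum>i\<in>UNIV. \<Sum>\<sigma>\<in>edges i K. F r i \<sigma> K)
        \<le> \<Lambda> * (r' K - r K)" for R
    proof -
      \<comment> \<open>Absolute values make \<open>C\<close> nonnegative: the bound then covers
        edges with zero flux too, and the sum \<open>\<Lambda>\<close> dominates the share of each
        cell.\<close>
      define C where "C = (\<lambda>K i \<sigma>. \<bar>edge_measure i \<sigma> * (\<bar>outward_comp w i \<sigma> K\<bar> + k i \<sigma> * R powr \<gamma>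
        + 2 * k i \<sigma> * R * (\<gamma> * R powr (\<gamma> - 1)))\<bar>)"
      define \<Lambda> where "\<Lambda> = (\<Sum>K\<in>M. \<Sum>i\<in>UNIV. \<Sum>\<sigma>\<in>edges i K. C K i \<sigma>)"
      have "(\<Sum>i\<in>UNIV. \<Sum>\<sigma>\<in>edges i K. F r' i \<sigma> K) - (\<Sum>i\<in>UNIV. \<Sum>\<sigma>\<in>edges i K. F r i \<sigma> K)
          \<le> \<Lambda> * (r' K - r K)"
        if K: "K \<in> M" and r: "\<And>L. 0 \<le> r L \<and> r L \<le> r' L \<and> r' L \<le> R" for K r r'
      proof -
        have "F r' i \<sigma> K - F r i \<sigma> K \<le> C K i \<sigma> * (r' K - r K)" if \<sigma>: "\<sigma> \<in> edges i K" for i \<sigma>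
        proof -
          have *: "upwind_flux (edge_measure i \<sigma>) (k i \<sigma>) \<gamma> a (r' K) (r' L)
              - upwind_flux (edge_measure i \<sigma>) (k i \<sigma>) \<gamma> a (r K) (r L)
              \<le> edge_measure i \<sigma> * (\<bar>a\<bar> + k i \<sigma> * R powr \<gamma>
                + 2 * k i \<sigma> * R * (\<gamma> * R powr (\<gamma> - 1))) * (r' K - r K)" for a L
            using r pos k0[OF K \<sigma>] edge_measure_nonneg[OF grid K \<sigma>]
            by (intro upwind_flux_one_sided_lipschitz) auto
          have "edge_measure i \<sigma> * (\<bar>outward_comp w i \<sigma> K\<bar> + k i \<sigma> * R powr \<gamma>
              + 2 * k i \<sigma> * R * (\<gamma> * R powr (\<gamma> - 1))) * (r' K - r K) \<le> C K i \<sigma> * (r' K - r K)"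
            unfolding C_def using r[of K] by (intro mult_right_mono) auto
          moreover have "0 \<le> C K i \<sigma> * (r' K - r K)"
            using r[of K] by (intro mult_nonneg_nonneg) (auto simp: C_def)
          ultimately show ?thesis
            using F_cases[OF K \<sigma>]
              order_trans[OF *[of "outward_comp w i \<sigma> K" "neighbour M i \<sigma> K"]]
            by (metis diff_self)
        qed
        then have "(\<Sum>i\<in>UNIV. \<Sum>\<sigma>\<in>edges i K. F r' i \<sigma> K - F r i \<sigma> K)
            \<le> (\<Sum>i\<in>UNIV. \<Sum>\<sigma>\<in>edges i K. C K i \<sigma> * (r' K - r K))"
          by (intro sum_mono)
        also have "\<dots> = (\<Sum>i\<in>UNIV. \<Sum>\<sigma>\<in>edges i K. C K i \<sigma>) * (r' K - r K)"
          by (simp add: sum_distrib_right)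
        also have "\<dots> \<le> \<Lambda> * (r' K - r K)"
        proof (rule mult_right_mono)
          show "(\<Sum>i\<in>UNIV. \<Sum>\<sigma>\<in>edges i K. C K i \<sigma>) \<le> \<Lambda>"
            unfolding \<Lambda>_def using mac_grid_finite[OF grid] K
            by (intro member_le_sum[of K M "\<lambda>K. \<Sum>i\<in>UNIV. \<Sum>\<sigma>\<in>edges i K. C K i \<sigma>"] sum_nonneg)
               (auto simp: C_def)
        qed (use r[of K] in simp)
        finally show ?thesis by (simp add: sum_subtractf)
      qed
      then show ?thesis by blast
    qed
    show "(\<lambda>n. \<Sum>i\<in>UNIV. \<Sum>\<sigma>\<in>edges i K. F (r n) i \<sigma> K) \<longlonglongrightarrow> (\<Sum>i\<in>UNIV. \<Sum>\<sigma>\<in>edges i K. F l i \<sigma> K)"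
      if K: "K \<in> M" and r: "\<And>n L. 0 \<le> r n L" "\<And>L. (\<lambda>n. r n L) \<longlonglongrightarrow> l L" for K r l
    proof (intro tendsto_sum)
      fix i \<sigma> assume \<sigma>: "\<sigma> \<in> edges i K"
      have "(\<lambda>n. upwind_flux (edge_measure i \<sigma>) (k i \<sigma>) \<gamma> a (r n K) (r n L))
          \<longlonglongrightarrow> upwind_flux (edge_measure i \<sigma>) (k i \<sigma>) \<gamma> a (l K) (l L)" for a L
        using r pos by (intro tendsto_upwind_flux) auto
      then show "(\<lambda>n. F (r n) i \<sigma> K) \<longlonglongrightarrow> F l i \<sigma> K"
        using F_cases[OF K \<sigma>] by (elim disjE conjE) simp_all
    qed
    show "(\<Sum>i\<in>UNIV. \<Sum>\<sigma>\<in>edges i K. F r i \<sigma> K) \<le> 0"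
      if K: "K \<in> M" and r: "\<And>L. 0 \<le> r L" "r K = 0" for K r
    proof (intro sum_nonpos)
      fix i \<sigma> assume \<sigma>: "\<sigma> \<in> edges i K"
      show "F r i \<sigma> K \<le> 0"
        using F_cases[OF K \<sigma>] upwind_flux_inflow[OF edge_measure_nonneg[OF grid K \<sigma>] r(1)] r(2)
        by (elim disjE conjE) simp_all
    qed
  qed
  then obtain r where r: "\<And>K. K \<in> M \<Longrightarrow> 0 < r K"
    "\<And>K. K \<in> M \<Longrightarrow> c K * (r K - b K) + (\<Sum>i\<in>UNIV. \<Sum>\<sigma>\<in>edges i K. F r i \<sigma> K) = 0" by blast
  have "1 / dt * (r K - b K) + 1 / measure lborel K * (\<Sum>i\<in>UNIV. \<Sum>\<sigma>\<in>edges i K. F r i \<sigma> K) = 0"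
    if "K \<in> M" for K
  proof -
    have "1 / dt * (r K - b K) + 1 / measure lborel K * S
        = (c K * (r K - b K) + S) / measure lborel K" for S
      using meas[OF that] pos by (simp add: c_def field_simps)
    then show ?thesis using r(2)[OF that] by simp
  qed
  then show ?thesis using r(1) unfolding F_def by blast
qed

text \<open>A density function reproduces \<open>r\<close> only on the cells of \<open>M\<close>.
  This suffices, because the neighbour across an internal edge is again in \<open>M\<close>.\<close>

lemma mass_flux_cong:
  assumes grid: "mac_grid \<Omega> M" and "open \<Omega>" and eq: "\<And>K. K \<in> M \<Longrightarrow> r K = r' K"
    and K: "K \<in> M" "\<sigma> \<in> edges i K"
  shows "mass_flux \<Omega> M s \<gamma> r w i \<sigma> K = mass_flux \<Omega> M s \<gamma> r' w i \<sigma> K"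
proof (cases "\<sigma> \<in> int_edges \<Omega> M i")
  case True
  obtain L where "L \<in> M" "neighbour M i \<sigma> K = L"
  proof -
    obtain A B where "A \<in> M" "B \<in> M" "adjacent_cells M i \<sigma> = {A, B}"
      "neighbour M i \<sigma> A = B" "neighbour M i \<sigma> B = A"
      using internal_edge_cells[OF grid \<open>open \<Omega>\<close> True] .
    moreover have "K \<in> adjacent_cells M i \<sigma>" using K by (simp add: adjacent_cells_def)
    ultimately show ?thesis using that by auto
  qed
  then show ?thesis
    using mass_flux_eq_upwind_flux[OF grid \<open>open \<Omega>\<close> True K] eq K(1) by simp
qed (simp add: mass_flux_def)

theorem theorem4p2:
  fixes \<Omega> :: "(real^'d::finite) set" and M :: "(real^'d) set set"
    and eps \<gamma> \<eta> dt :: real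
    and \<rho>\<^sub>0 :: "real^'d \<Rightarrow> real" and u\<^sub>0 :: "'d \<Rightarrow> real^'d \<Rightarrow> real"
  assumes "CARD('d) = 2 \<or> CARD('d) = 3"
    and "mac_domain \<Omega>" and "mac_grid \<Omega> M"
    and "0 < eps" and "eps \<le> 1" and "1 \<le> \<gamma>" and "0 < \<eta>" and "0 < dt"
    and "\<rho>\<^sub>0 \<in> L_space M" and "u\<^sub>0 \<in> H_space \<Omega> M"
    and "positive_on_cells M \<rho>\<^sub>0"
  shows "\<exists>\<rho>\<^sub>1 u\<^sub>1. \<rho>\<^sub>1 \<in> L_space M \<and> u\<^sub>1 \<in> H_space \<Omega> M \<and>
           mass_balance \<Omega> M eps \<gamma> \<eta> dt \<rho>\<^sub>0 u\<^sub>0 \<rho>\<^sub>1 \<and>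
           momentum_balance \<Omega> M eps \<gamma> \<eta> dt \<rho>\<^sub>0 u\<^sub>0 \<rho>\<^sub>1 u\<^sub>1 \<and>
           positive_on_cells M \<rho>\<^sub>1"
proof -
  note grid = \<open>mac_grid \<Omega> M\<close>
  have "open \<Omega>" using \<open>mac_domain \<Omega>\<close> by (simp add: mac_domain_def)
  have "0 < val \<rho>\<^sub>0 K" if K: "K \<in> M" for K
  proof -
    obtain x where x: "x \<in> interior K" using mac_grid_interior_nonempty[OF grid K] by blast
    have "const_on K \<rho>\<^sub>0" using \<open>\<rho>\<^sub>0 \<in> L_space M\<close> K by (simp add: L_space_def)
    then show ?thesis
      using const_on_imp_eq_val[OF _ x] \<open>positive_on_cells M \<rho>\<^sub>0\<close> K x by (metis positive_on_cells_def)
  qed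
  moreover have "0 \<le> \<eta> * dt / eps\<^sup>2" using \<open>0 < \<eta>\<close> \<open>0 < dt\<close> by simp
  ultimately obtain r where r: "\<And>K. K \<in> M \<Longrightarrow> 0 < r K"
    "\<And>K. K \<in> M \<Longrightarrow> 1 / dt * (r K - val \<rho>\<^sub>0 K) + 1 / measure lborel K * (\<Sum>i\<in>UNIV. \<Sum>\<sigma>\<in>edges i K.
       mass_flux \<Omega> M (\<eta> * dt / eps\<^sup>2) \<gamma> r (edge_val M u\<^sub>0) i \<sigma> K) = 0"
    using mass_balance_solvable[OF grid \<open>open \<Omega>\<close> \<open>1 \<le> \<gamma>\<close> _ \<open>0 < dt\<close>,
      of "\<eta> * dt / eps\<^sup>2" "val \<rho>\<^sub>0" "edge_val M u\<^sub>0"] by blast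
  obtain \<rho>\<^sub>1 where \<rho>\<^sub>1: "\<And>K. K \<in> M \<Longrightarrow> const_on K \<rho>\<^sub>1" "\<And>K. K \<in> M \<Longrightarrow> val \<rho>\<^sub>1 K = r K"
    using piecewise_constant_exists[of M "\<lambda>K. K" r] mac_grid_interior_nonempty[OF grid]
      mac_grid_interior_disjoint[OF grid] by blast
  have mass: "mass_balance \<Omega> M eps \<gamma> \<eta> dt \<rho>\<^sub>0 u\<^sub>0 \<rho>\<^sub>1"
    unfolding mass_balance_def Let_def
  proof
    fix K assume K: "K \<in> M"
    have "mass_flux \<Omega> M (\<eta> * dt / eps\<^sup>2) \<gamma> (val \<rho>\<^sub>1) (edge_val M u\<^sub>0) i \<sigma> K
        = mass_flux \<Omega> M (\<eta> * dt / eps\<^sup>2) \<gamma> r (edge_val M u\<^sub>0) i \<sigma> K" if "\<sigma> \<in> edges i K" for i \<sigma>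
      using \<rho>\<^sub>1(2) K that by (intro mass_flux_cong[OF grid \<open>open \<Omega>\<close>]) auto
    then show "1 / dt * (val \<rho>\<^sub>1 K - val \<rho>\<^sub>0 K) + 1 / measure lborel K * (\<Sum>i\<in>UNIV. \<Sum>\<sigma>\<in>edges i K.
        mass_flux \<Omega> M (\<eta> * dt / eps\<^sup>2) \<gamma> (val \<rho>\<^sub>1) (edge_val M u\<^sub>0) i \<sigma> K) = 0"
      using r(2)[OF K] \<rho>\<^sub>1(2)[OF K] by simp
  qed
  define F where "F = mass_flux \<Omega> M (\<eta> * dt / eps\<^sup>2) \<gamma> (val \<rho>\<^sub>1) (edge_val M u\<^sub>0)"
  \<comment> \<open>The momentum balance without its time difference. Only
    \<open>\<rho>\<^sub>1\<close> and \<open>u\<^sub>0\<close> enter, so \<open>N\<close> is known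
    at this stage.\<close>
  define N where "N = (\<lambda>i \<sigma>. 1 / measure lborel (dual_cell M i \<sigma>)
      * (\<Sum>j\<in>UNIV. \<Sum>\<epsilon>\<in>edges j (dual_cell M i \<sigma>).
          dual_flux \<Omega> M F i \<sigma> j \<epsilon> * upwind_val \<Omega> M F (edge_val M u\<^sub>0) i \<sigma> j \<epsilon>)
      + 1 / eps\<^sup>2 * discrete_deriv \<Omega> M (\<lambda>K. pressure \<gamma> (val \<rho>\<^sub>1 K)) i \<sigma>)"
  \<comment> \<open>The balance solved for the new velocity; the default \<open>0\<close> supplies
    the boundary condition of \<open>H_space\<close> on external edges.\<close>
  define W where "W = (\<lambda>i \<sigma>. if \<sigma> \<in> int_edges \<Omega> M i then
      (dual_avg M (val \<rho>\<^sub>0) i \<sigma> * edge_val M u\<^sub>0 i \<sigma> - dt * N i \<sigma>) / dual_avg M (val \<rho>\<^sub>1) i \<sigma> else 0)"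
  have "\<exists>f. \<forall>\<sigma>\<in>mesh_edges M i. const_on (dual_cell M i \<sigma>) f \<and> val f (dual_cell M i \<sigma>) = W i \<sigma>" for i
    using dual_cell_interior[OF grid] dual_cells_disjoint[OF grid]
    by (intro piecewise_constant_exists) auto
  then obtain u\<^sub>1 where u\<^sub>1: "\<And>i \<sigma>. \<sigma> \<in> mesh_edges M i \<Longrightarrow> const_on (dual_cell M i \<sigma>) (u\<^sub>1 i)"
    "\<And>i \<sigma>. \<sigma> \<in> mesh_edges M i \<Longrightarrow> edge_val M u\<^sub>1 i \<sigma> = W i \<sigma>"
    by metis
  have "u\<^sub>1 \<in> H_space \<Omega> M"
    using u\<^sub>1 by (auto simp: H_space_def H_space_comp_def W_def int_edges_def ext_edges_def)
  moreover have "momentum_balance \<Omega> M eps \<gamma> \<eta> dt \<rho>\<^sub>0 u\<^sub>0 \<rho>\<^sub>1 u\<^sub>1"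
    unfolding momentum_balance_def Let_def F_def[symmetric]
  proof (intro allI ballI)
    fix i \<sigma> assume \<sigma>: "\<sigma> \<in> int_edges \<Omega> M i"
    then have mesh: "\<sigma> \<in> mesh_edges M i" by (simp add: int_edges_def)
    have "0 < dual_avg M (val \<rho>\<^sub>1) i \<sigma>" using r(1) \<rho>\<^sub>1(2) by (intro dual_avg_pos[OF grid mesh]) simp
    then have "1 / dt * (dual_avg M (val \<rho>\<^sub>1) i \<sigma> * edge_val M u\<^sub>1 i \<sigma>
        - dual_avg M (val \<rho>\<^sub>0) i \<sigma> * edge_val M u\<^sub>0 i \<sigma>) + N i \<sigma> = 0"
      using \<sigma> \<open>0 < dt\<close> unfolding u\<^sub>1(2)[OF mesh] W_def by simp
    then show "1 / dt * (dual_avg M (val \<rho>\<^sub>1) i \<sigma> * edge_val M u\<^sub>1 i \<sigma>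
        - dual_avg M (val \<rho>\<^sub>0) i \<sigma> * edge_val M u\<^sub>0 i \<sigma>)
      + 1 / measure lborel (dual_cell M i \<sigma>)
          * (\<Sum>j\<in>UNIV. \<Sum>\<epsilon>\<in>edges j (dual_cell M i \<sigma>).
               dual_flux \<Omega> M F i \<sigma> j \<epsilon> * upwind_val \<Omega> M F (edge_val M u\<^sub>0) i \<sigma> j \<epsilon>)
      + 1 / eps\<^sup>2 * discrete_deriv \<Omega> M (\<lambda>K. pressure \<gamma> (val \<rho>\<^sub>1 K)) i \<sigma> = 0"
      unfolding N_def by linarith
  qed
  moreover have "\<rho>\<^sub>1 \<in> L_space M" using \<rho>\<^sub>1(1) by (simp add: L_space_def)
  moreover have "positive_on_cells M \<rho>\<^sub>1"
    using r(1) \<rho>\<^sub>1 const_on_imp_eq_val by (metis positive_on_cells_def)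
  ultimately show ?thesis using mass by blast
qed

end
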